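(* Let $N\in\mathbb{N}$, $T>0$, $\alpha\in(1,2]$, $a_0,a_1\in\mathbb{R}^N$ and $m-1<\beta\le m$ for some $m\in\mathbb{N}$. Assume $P\in(W^{m,\infty}(0,T))^{N\times N}$ and $$F+Pa_0+tPa_1\in(H_\beta(0,T))^N.$$ Then the solution $u$ to $$\partial_t^\alpha(u-a_0-ta_1)=P(t)u(t)+F(t),\quad 0<t<T,\qquad u-a_0-ta_1\in(H_\alpha(0,T))^N,$$ satisfies $u-a_0-ta_1\in(H_{\alpha+\beta}(0,T))^N$.
   Context: For $\gamma>0$ and $w\in L^2(0,T)$ (real-valued), $J^\gamma w(t)=\frac{1}{\Gamma(\gamma)}\int_0^t(t-s)^{\gamma-1}w(s)\,ds$; $J^\gamma$ is bounded and injective on $L^2(0,T)$. $H_\gamma(0,T):=J^\gamma L^2(0,T)$ with norm $\|v\|_{H_\gamma(0,T)}:=\|(J^\gamma)^{-1}v\|_{L^2(0,T)}$, and $\partial_t^\gamma:=(J^\gamma)^{-1}$ with domain $H_\gamma(0,T)$, acting componentwise on vector-valued functions. "The solution" is the unique $u\in(L^2(0,T))^N$ with $u-a_0-ta_1\in(H_\alpha(0,T))^N$ satisfying the equation for almost every $t\in(0,T)$ (it exists and is unique for $F\in(L^2(0,T))^N$ and $P\in(L^\infty(0,T))^{N\times N}$). $\mathbb{N}=\{1,2,\dots\}$. *)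

theory Defs
  imports "HOL-Analysis.Analysis"
begin

text \<open>Elements of the function spaces over the interval (0,T) are represented by functions on
  the real line; only their values almost everywhere on (0,T) matter.\<close>

definition L2 :: "real \<Rightarrow> (real \<Rightarrow> real) set" where
  "L2 T = {w \<in> borel_measurable (lebesgue_on {0<..<T}).
             integrable (lebesgue_on {0<..<T}) (\<lambda>t. (w t)\<^sup>2)}"

definition Linf :: "real \<Rightarrow> (real \<Rightarrow> real) set" where
  "Linf T = {f \<in> borel_measurable (lebesgue_on {0<..<T}).
               \<exists>C. AE t in lebesgue_on {0<..<T}. \<bar>f t\<bar> \<le> C}"

definition test_fun :: "real \<Rightarrow> (real \<Rightarrow> real) set" where
  "test_fun T = {\<phi>. (\<forall>k. (deriv ^^ k) \<phi> differentiable_on UNIV) \<and>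
                     (\<exists>K. compact K \<and> K \<subseteq> {0<..<T} \<and> (\<forall>x. x \<notin> K \<longrightarrow> \<phi> x = 0))}"

definition weak_deriv :: "nat \<Rightarrow> real \<Rightarrow> (real \<Rightarrow> real) \<Rightarrow> (real \<Rightarrow> real) \<Rightarrow> bool" where
  "weak_deriv k T f g \<longleftrightarrow>
     (\<forall>\<phi>\<in>test_fun T.
        (LINT t|lebesgue_on {0<..<T}. f t * (deriv ^^ k) \<phi> t) =
        (-1) ^ k * (LINT t|lebesgue_on {0<..<T}. g t * \<phi> t))"

definition sobolev_inf :: "nat \<Rightarrow> real \<Rightarrow> (real \<Rightarrow> real) set" where
  "sobolev_inf m T = {f \<in> Linf T. \<forall>k\<le>m. \<exists>g\<in>Linf T. weak_deriv k T f g}"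

definition frac_int :: "real \<Rightarrow> (real \<Rightarrow> real) \<Rightarrow> real \<Rightarrow> real" where
  "frac_int \<gamma> w t = 1 / Gamma \<gamma> * (LINT s:{0<..<t}|lebesgue. (t - s) powr (\<gamma> - 1) * w s)"

definition frac_sobolev :: "real \<Rightarrow> real \<Rightarrow> (real \<Rightarrow> real) set" where
  "frac_sobolev \<gamma> T =
     {v. \<exists>w\<in>L2 T. AE t in lebesgue_on {0<..<T}. v t = frac_int \<gamma> w t}"

text \<open>The inverse of the fractional integral on its range. As the fractional integral is injective
  on classes of almost everywhere equal functions, the choice below is determined up to a null
  set; it is meaningful only for arguments in the range.\<close>

definition frac_deriv :: "real \<Rightarrow> real \<Rightarrow> (real \<Rightarrow> real) \<Rightarrow> real \<Rightarrow> real" where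
  "frac_deriv \<gamma> T v =
     (SOME w. w \<in> L2 T \<and> (AE t in lebesgue_on {0<..<T}. v t = frac_int \<gamma> w t))"

definition vec_in :: "(real \<Rightarrow> real) set \<Rightarrow> (real \<Rightarrow> real ^ 'n) set" where
  "vec_in X = {v. \<forall>i. (\<lambda>t. v t $ i) \<in> X}"

definition mat_in :: "(real \<Rightarrow> real) set \<Rightarrow> (real \<Rightarrow> real ^ 'n ^ 'n) set" where
  "mat_in X = {P. \<forall>i j. (\<lambda>t. P t $ i $ j) \<in> X}"

definition vec_frac_deriv :: "real \<Rightarrow> real \<Rightarrow> (real \<Rightarrow> real ^ 'n) \<Rightarrow> real \<Rightarrow> real ^ 'n" where
  "vec_frac_deriv \<gamma> T v t = (\<chi> i. frac_deriv \<gamma> T (\<lambda>s. v s $ i) t)"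

definition is_solution ::
  "real \<Rightarrow> real \<Rightarrow> real ^ 'n \<Rightarrow> real ^ 'n \<Rightarrow> (real \<Rightarrow> real ^ 'n ^ 'n) \<Rightarrow> (real \<Rightarrow> real ^ 'n)
     \<Rightarrow> (real \<Rightarrow> real ^ 'n) \<Rightarrow> bool" where
  "is_solution \<alpha> T a0 a1 P F u \<longleftrightarrow>
     u \<in> vec_in (L2 T) \<and>
     (\<lambda>t. u t - a0 - t *\<^sub>R a1) \<in> vec_in (frac_sobolev \<alpha> T) \<and>
     (AE t in lebesgue_on {0<..<T}.
        vec_frac_deriv \<alpha> T (\<lambda>t. u t - a0 - t *\<^sub>R a1) t = P t *v u t + F t)"

end

theory Submission
  imports Defs
begin

text \<open>Write \<open>v = u - a\<^sub>0 - t a\<^sub>1 = J\<^sup>\<alpha> w\<close> and \<open>G = F + P a\<^sub>0 + t P a\<^sub>1\<close>. The equation reads \<open>w = P v + G\<close>, and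
  it suffices to prove that \<open>w\<close> lies in \<open>H\<^sub>\<beta>\<close>, for then \<open>v = J\<^sup>\<alpha> w\<close> lies in \<open>H\<^bsub>\<alpha> + \<beta>\<^esub>\<close> by the semigroup law.

  This is a bootstrap in steps of integer length. If \<open>w \<in> H\<^sub>k\<close> with \<open>k \<le> m - 1\<close>, then \<open>v \<in> H\<^bsub>\<alpha> + k\<^esub> \<subseteq> H\<^bsub>k + 1\<^esub>\<close>
  because \<open>\<alpha> > 1\<close>; multiplication by \<open>P \<in> W\<^bsup>k + 1,\<infinity>\<^esup>\<close> preserves \<open>H\<^bsub>k + 1\<^esub>\<close>; hence \<open>w = P v + G\<close> lies in
  \<open>H\<close> of order \<open>min (k + 1) \<beta>\<close>. Starting from \<open>w \<in> L\<^sup>2 = H\<^sub>0\<close>, the order \<open>\<beta>\<close> is reached after \<open>m\<close> steps. Since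
  \<open>\<alpha> > 1\<close> gains a whole order each time, multiplication has to be understood only on spaces of integer
  order, where it is a matter of the product rule (\<open>sobolev_inf_mult_rl_space\<close>).

  Two ingredients carry this. The first is the theory of \<open>J\<^sup>\<gamma>\<close> on \<open>L\<^sup>2\<close>: the semigroup law
  (\<open>rl_int_semigroup\<close>, from the Beta integral and Fubini) and boundedness (\<open>cutoff_rl_int_sq_int\<close>, from
  Cauchy-Schwarz), which together give the inclusions between the spaces. The second is that a bounded
  function with a bounded weak derivative is almost everywhere a constant plus the primitive of that
  derivative (\<open>primitive_of_weak_derivative\<close>). It follows from the lemma of du Bois-Reymond, which rests
  on explicit smooth bump functions built from \<open>exp(-1/x)\<close>.\<close>

section \<open>Riemann-Liouville integrals\<close>

definition rl_kernel :: "real \<Rightarrow> real \<Rightarrow> real" where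
  "rl_kernel \<gamma> x = (if 0 < x then x powr (\<gamma> - 1) / Gamma \<gamma> else 0)"

text \<open>Setting the integral of order \<open>0\<close> to the identity lets the semigroup law and the inclusions
  between the spaces below hold for all orders \<open>\<gamma> \<ge> 0\<close>, so that no difference of orders that happens
  to vanish needs separate treatment. (The kernel formula itself would give \<open>0\<close> there.)\<close>
definition rl_int :: "real \<Rightarrow> (real \<Rightarrow> real) \<Rightarrow> real \<Rightarrow> real" where
  "rl_int \<gamma> w t = (if \<gamma> = 0 then w t else (\<integral>s. rl_kernel \<gamma> (t - s) * w s \<partial>lborel))"

text \<open>Borel functions that vanish off the interval: each class in \<open>L\<^sup>2(0,T)\<close> has such a representative,
  and with it every integral over a subinterval becomes a convolution over the whole line with
  respect to \<^const>\<open>lborel\<close>, where Tonelli and Fubini apply.\<close>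
definition sq_int :: "real \<Rightarrow> (real \<Rightarrow> real) set" where
  "sq_int T = {w \<in> borel_measurable borel.
                 (\<forall>t. t \<notin> {0<..<T} \<longrightarrow> w t = 0) \<and> integrable lborel (\<lambda>t. (w t)\<^sup>2)}"

definition cutoff :: "real \<Rightarrow> (real \<Rightarrow> real) \<Rightarrow> real \<Rightarrow> real" where
  "cutoff T f t = (if t \<in> {0<..<T} then f t else 0)"

lemma rl_kernel_measurable [measurable]: "rl_kernel \<gamma> \<in> borel_measurable borel"
  unfolding rl_kernel_def[abs_def] by measurable

lemma rl_kernel_nonneg [simp]: "0 < \<gamma> \<Longrightarrow> 0 \<le> rl_kernel \<gamma> x"
  by (simp add: rl_kernel_def)

lemma rl_kernel_eq_0: "x \<le> 0 \<Longrightarrow> rl_kernel \<gamma> x = 0"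
  by (simp add: rl_kernel_def)

lemma rl_kernel_1: "rl_kernel 1 x = (if 0 < x then 1 else 0)"
  by (simp add: rl_kernel_def)

lemma rl_kernel_mono:
  assumes "1 \<le> \<gamma>" "x \<le> y" shows "rl_kernel \<gamma> x \<le> rl_kernel \<gamma> y"
  using assms by (auto simp: rl_kernel_def intro!: divide_right_mono powr_mono2)

text \<open>The substitution \<open>s = r + (t - r) x\<close> turns the left-hand side into Euler's Beta integral, whose value
  \<open>\<Gamma>(b) \<Gamma>(a) / \<Gamma>(a + b)\<close> is exactly what the normalisation of the kernels absorbs.\<close>
lemma rl_kernel_convolution:
  assumes a: "0 < a" and b: "0 < b"
  shows "(\<integral>\<^sup>+s. ennreal (rl_kernel a (t - s) * rl_kernel b (s - r)) \<partial>lborel)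
           = ennreal (rl_kernel (a + b) (t - r))"
proof (cases "r < t")
  case False
  then have *: "rl_kernel a (t - s) * rl_kernel b (s - r) = 0" for s
    by (cases "s < t") (auto simp: rl_kernel_eq_0)
  show ?thesis using False unfolding * by (simp add: rl_kernel_eq_0)
next
  case True
  define c where "c = t - r"
  define B where "B x = (if x \<in> {0..1} then x powr (b - 1) * (1 - x) powr (a - 1) else (0::real))" for x
  have c: "0 < c" using True by (simp add: c_def)
  have [measurable]: "B \<in> borel_measurable borel" unfolding B_def[abs_def] by measurable
  have B0: "0 \<le> B x" for x by (simp add: B_def)
  have "(B has_integral Beta b a) UNIV"
    using has_integral_Beta_real[OF b a] unfolding B_def[abs_def] has_integral_restrict_UNIV .
  then have B: "(\<integral>\<^sup>+x. ennreal (B x) \<partial>lborel) = ennreal (Beta b a)"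
    by (rule nn_integral_has_integral_lborel[rotated 2]) (auto simp: B_def)
  have *: "rl_kernel a (t - (r + c * x)) * rl_kernel b ((r + c * x) - r)
         = c powr (a + b - 2) / (Gamma a * Gamma b) * B x" if "x \<notin> {0, 1}" for x
  proof (cases "x \<in> {0<..<1}")
    case True
    then have x: "0 < x" "x < 1" by auto
    have e: "t - (r + c * x) = c * (1 - x)" by (simp add: c_def algebra_simps)
    have "c powr (a + b - 2) = c powr (a - 1) * c powr (b - 1)"
      by (simp flip: powr_add)
    then show ?thesis using x c unfolding e
      by (simp add: rl_kernel_def B_def powr_mult)
  next
    case False
    with that have "x < 0 \<or> 1 < x" by auto
    moreover have "t - (r + c * x) = c * (1 - x)" by (simp add: c_def algebra_simps)
    ultimately show ?thesis using c by (auto simp: B_def rl_kernel_eq_0 mult_le_0_iff)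
  qed
  have "(\<integral>\<^sup>+s. ennreal (rl_kernel a (t - s) * rl_kernel b (s - r)) \<partial>lborel)
      = \<bar>c\<bar> * (\<integral>\<^sup>+x. ennreal (rl_kernel a (t - (r + c * x)) * rl_kernel b ((r + c * x) - r)) \<partial>lborel)"
    using c by (intro nn_integral_real_affine) auto
  also have "(\<integral>\<^sup>+x. ennreal (rl_kernel a (t - (r + c * x)) * rl_kernel b ((r + c * x) - r)) \<partial>lborel)
      = (\<integral>\<^sup>+x. ennreal (c powr (a + b - 2) / (Gamma a * Gamma b)) * ennreal (B x) \<partial>lborel)"
  proof (rule nn_integral_cong_AE)
    have "AE x in lborel. x \<notin> {0, 1::real}"
      by (rule AE_not_in) (auto intro!: countable_imp_null_set_lborel)
    then show "AE x in lborel. ennreal (rl_kernel a (t - (r + c * x)) * rl_kernel b ((r + c * x) - r))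
       = ennreal (c powr (a + b - 2) / (Gamma a * Gamma b)) * ennreal (B x)"
      by eventually_elim (subst *, use a b B0 in \<open>auto simp flip: ennreal_mult\<close>)
  qed
  also have "\<dots> = ennreal (c powr (a + b - 2) / (Gamma a * Gamma b)) * ennreal (Beta b a)"
    by (simp add: nn_integral_cmult B)
  also have "\<bar>c\<bar> * \<dots> = ennreal (rl_kernel (a + b) (t - r))"
  proof -
    have "c * c powr (a + b - 2) = c powr 1 * c powr (a + b - 2)" using c by simp
    also have "\<dots> = c powr (a + b - 1)" by (subst powr_add[symmetric]) simp
    finally have p: "c * c powr (a + b - 2) = c powr (a + b - 1)" .
    have G: "Gamma a > 0" "Gamma b > 0" "Gamma (a + b) > 0" using a b by auto
    have "c * (c powr (a + b - 2) / (Gamma a * Gamma b) * Beta b a)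
        = (c * c powr (a + b - 2)) / (Gamma a * Gamma b) * Beta b a" by simp
    also have "\<dots> = rl_kernel (a + b) c"
      unfolding p using c G by (simp add: rl_kernel_def Beta_def field_simps)
    finally have "c * (c powr (a + b - 2) / (Gamma a * Gamma b) * Beta b a) = rl_kernel (a + b) c" .
    moreover have "0 \<le> Beta b a" using G by (simp add: Beta_def add.commute)
    ultimately show ?thesis using c G
      by (simp add: c_def flip: ennreal_mult)
  qed
  finally show ?thesis .
qed

text \<open>Tonelli moves the convolution onto the two kernels. The version for nonnegative functions comes
  first because it supplies the integrability that Fubini needs for signed ones.\<close>
lemma rl_nn_semigroup:
  fixes g :: "real \<Rightarrow> ennreal"
  assumes a: "0 < a" and b: "0 < b" and [measurable]: "g \<in> borel_measurable borel"
  shows "(\<integral>\<^sup>+s. ennreal (rl_kernel a (t - s)) * (\<integral>\<^sup>+r. ennreal (rl_kernel b (s - r)) * g r \<partial>lborel) \<partial>lborel)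
           = (\<integral>\<^sup>+r. ennreal (rl_kernel (a + b) (t - r)) * g r \<partial>lborel)"
proof -
  have "(\<integral>\<^sup>+s. ennreal (rl_kernel a (t - s)) * (\<integral>\<^sup>+r. ennreal (rl_kernel b (s - r)) * g r \<partial>lborel) \<partial>lborel)
      = (\<integral>\<^sup>+s. (\<integral>\<^sup>+r. ennreal (rl_kernel a (t - s)) * (ennreal (rl_kernel b (s - r)) * g r) \<partial>lborel) \<partial>lborel)"
    by (simp add: nn_integral_cmult)
  also have "\<dots> = (\<integral>\<^sup>+r. (\<integral>\<^sup>+s. ennreal (rl_kernel a (t - s)) * (ennreal (rl_kernel b (s - r)) * g r) \<partial>lborel) \<partial>lborel)"
    by (rule lborel_pair.Fubini') measurable
  also have "\<dots> = (\<integral>\<^sup>+r. (\<integral>\<^sup>+s. ennreal (rl_kernel a (t - s) * rl_kernel b (s - r)) * g r \<partial>lborel) \<partial>lborel)"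
    using a b by (simp add: ennreal_mult mult.assoc)
  also have "\<dots> = (\<integral>\<^sup>+r. ennreal (rl_kernel (a + b) (t - r)) * g r \<partial>lborel)"
    by (simp add: nn_integral_multc rl_kernel_convolution[OF a b])
  finally show ?thesis .
qed

text \<open>Integration over \<open>t < T\<close> is itself the operator of order \<open>1\<close> evaluated at \<open>T\<close>, so the bound is an
  instance of the semigroup law together with the monotonicity of the kernel of order \<open>\<gamma> + 1 \<ge> 1\<close>.\<close>
lemma rl_nn_integral_le:
  fixes g :: "real \<Rightarrow> ennreal"
  assumes \<gamma>: "0 < \<gamma>" and g [measurable]: "g \<in> borel_measurable borel" and g0: "\<And>s. s \<le> 0 \<Longrightarrow> g s = 0"
  shows "(\<integral>\<^sup>+t. indicator {..<T} t * (\<integral>\<^sup>+s. ennreal (rl_kernel \<gamma> (t - s)) * g s \<partial>lborel) \<partial>lborel)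
           \<le> ennreal (rl_kernel (\<gamma> + 1) T) * (\<integral>\<^sup>+s. g s \<partial>lborel)"
proof -
  have "(\<integral>\<^sup>+t. indicator {..<T} t * (\<integral>\<^sup>+s. ennreal (rl_kernel \<gamma> (t - s)) * g s \<partial>lborel) \<partial>lborel)
     = (\<integral>\<^sup>+t. ennreal (rl_kernel 1 (T - t)) * (\<integral>\<^sup>+s. ennreal (rl_kernel \<gamma> (t - s)) * g s \<partial>lborel) \<partial>lborel)"
    by (intro nn_integral_cong) (auto simp: rl_kernel_1 indicator_def)
  also have "\<dots> = (\<integral>\<^sup>+s. ennreal (rl_kernel (1 + \<gamma>) (T - s)) * g s \<partial>lborel)"
    by (rule rl_nn_semigroup) (use \<gamma> in auto)
  also have "\<dots> \<le> (\<integral>\<^sup>+s. ennreal (rl_kernel (\<gamma> + 1) T) * g s \<partial>lborel)"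
  proof (rule nn_integral_mono)
    fix s show "ennreal (rl_kernel (1 + \<gamma>) (T - s)) * g s \<le> ennreal (rl_kernel (\<gamma> + 1) T) * g s"
      using g0[of s] \<gamma>
      by (cases "s \<le> 0") (auto intro!: mult_right_mono ennreal_leI rl_kernel_mono simp: add.commute)
  qed
  also have "\<dots> = ennreal (rl_kernel (\<gamma> + 1) T) * (\<integral>\<^sup>+s. g s \<partial>lborel)"
    by (simp add: nn_integral_cmult)
  finally show ?thesis .
qed

lemma sq_intD:
  assumes "w \<in> sq_int T"
  shows sq_int_measurable: "w \<in> borel_measurable borel"
    and sq_int_outside: "t \<notin> {0<..<T} \<Longrightarrow> w t = 0"
    and sq_int_square: "integrable lborel (\<lambda>t. (w t)\<^sup>2)"
  using assms by (auto simp: sq_int_def)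

lemma sq_int_integrable:
  assumes "w \<in> sq_int T" shows "integrable lborel w"
proof (rule Bochner_Integration.integrable_bound)
  note [measurable] = sq_int_measurable[OF assms]
  show "integrable lborel (\<lambda>t. (w t)\<^sup>2 + indicator {0<..<T} t)"
    using sq_int_square[OF assms] by (intro Bochner_Integration.integrable_add) (auto intro!: integrable_real_indicator emeasure_bounded_finite)
  have "\<bar>w t\<bar> \<le> (w t)\<^sup>2 + indicator {0<..<T} t" for t
  proof (cases "t \<in> {0<..<T}")
    case True
    have "0 \<le> (\<bar>w t\<bar> - 1/2)\<^sup>2" by simp
    also have "\<dots> = (w t)\<^sup>2 - \<bar>w t\<bar> + 1/4" by (simp add: power2_eq_square algebra_simps)
    finally show ?thesis using True by simp
  qed (use sq_int_outside[OF assms] in auto)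
  then show "AE t in lborel. norm (w t) \<le> norm ((w t)\<^sup>2 + indicator {0<..<T} t)"
    by (intro AE_I2) (auto intro: order_trans)
  show "w \<in> borel_measurable lborel" by measurable
qed

lemma rl_int_measurable [measurable (raw)]:
  assumes [measurable]: "w \<in> borel_measurable borel"
  shows "rl_int \<gamma> w \<in> borel_measurable borel"
  unfolding rl_int_def[abs_def] by measurable

lemma cutoff_measurable [measurable (raw)]:
  assumes [measurable]: "f \<in> borel_measurable borel"
  shows "cutoff T f \<in> borel_measurable borel"
  unfolding cutoff_def[abs_def] by measurable

lemma rl_int_finite:
  assumes \<gamma>: "0 < \<gamma>" and w: "w \<in> sq_int T"
  shows "AE t in lborel. t < T \<longrightarrow> (\<integral>\<^sup>+s. ennreal (rl_kernel \<gamma> (t - s)) * ennreal \<bar>w s\<bar> \<partial>lborel) < \<infinity>"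
proof -
  note [measurable] = sq_int_measurable[OF w]
  have "(\<integral>\<^sup>+t. indicator {..<T} t * (\<integral>\<^sup>+s. ennreal (rl_kernel \<gamma> (t - s)) * ennreal \<bar>w s\<bar> \<partial>lborel) \<partial>lborel)
      \<le> ennreal (rl_kernel (\<gamma> + 1) T) * (\<integral>\<^sup>+s. ennreal \<bar>w s\<bar> \<partial>lborel)"
    by (rule rl_nn_integral_le) (use \<gamma> sq_int_outside[OF w] in auto)
  also have "\<dots> < \<infinity>"
    using sq_int_integrable[OF w] by (auto simp: integrable_iff_bounded ennreal_mult_less_top)
  finally have "AE t in lborel. indicator {..<T} t * (\<integral>\<^sup>+s. ennreal (rl_kernel \<gamma> (t - s)) * ennreal \<bar>w s\<bar> \<partial>lborel) \<noteq> \<infinity>"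
    by (intro nn_integral_noteq_infinite) auto
  then show ?thesis by eventually_elim (auto simp: less_top)
qed

lemma rl_int_integrable:
  assumes \<gamma>: "0 < \<gamma>" and w: "w \<in> sq_int T"
  shows "AE t in lborel. t < T \<longrightarrow> integrable lborel (\<lambda>s. rl_kernel \<gamma> (t - s) * w s)"
  using rl_int_finite[OF assms]
proof eventually_elim
  case (elim t)
  note [measurable] = sq_int_measurable[OF w]
  show ?case using elim \<gamma> by (auto intro!: integrableI_bounded simp: abs_mult ennreal_mult)
qed

lemma rl_int_outside:
  assumes "w \<in> sq_int T" "t \<le> 0" shows "rl_int \<gamma> w t = 0"
proof -
  have *: "rl_kernel \<gamma> (t - s) * w s = 0" for s
    using sq_int_outside[OF assms(1), of s] assms(2) by (cases "s \<le> 0") (auto simp: rl_kernel_eq_0)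
  show ?thesis using sq_int_outside[OF assms(1), of t] assms(2) unfolding rl_int_def * by simp
qed

lemma abs_rl_int_le:
  assumes [measurable]: "w \<in> borel_measurable borel" and \<gamma>: "0 < \<gamma>"
  shows "ennreal \<bar>rl_int \<gamma> w t\<bar> \<le> (\<integral>\<^sup>+s. ennreal (rl_kernel \<gamma> (t - s)) * ennreal \<bar>w s\<bar> \<partial>lborel)"
proof (cases "integrable lborel (\<lambda>s. rl_kernel \<gamma> (t - s) * w s)")
  case True
  from integral_norm_bound_ennreal[OF this] show ?thesis
    using \<gamma> by (simp add: rl_int_def abs_mult ennreal_mult)
next
  case False
  then show ?thesis using \<gamma> by (simp add: rl_int_def not_integrable_integral_eq)
qed

text \<open>The operator is bounded on \<open>L\<^sup>2\<close>: splitting the kernel as a product of two square roots,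
  Cauchy-Schwarz gives \<open>(J\<^sup>\<gamma> w)\<^sup>2 \<le> M J\<^sup>\<gamma>(w\<^sup>2)\<close> with \<open>M\<close> the mass of the kernel on \<open>(0,T)\<close>, and the
  integral of the right-hand side is controlled by the \<open>L\<^sup>1\<close> bound.\<close>
lemma cutoff_rl_int_sq_int:
  assumes \<gamma>: "0 \<le> \<gamma>" and w: "w \<in> sq_int T"
  shows "cutoff T (rl_int \<gamma> w) \<in> sq_int T"
proof (cases "\<gamma> = 0")
  case True
  then have "cutoff T (rl_int \<gamma> w) = w"
    using sq_int_outside[OF w] by (auto simp: cutoff_def rl_int_def)
  then show ?thesis using w by simp
next
  case False
  with \<gamma> have \<gamma>: "0 < \<gamma>" by simp
  note [measurable] = sq_int_measurable[OF w]
  define M where "M = ennreal (rl_kernel (\<gamma> + 1) T)"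
  have pt: "ennreal ((cutoff T (rl_int \<gamma> w) t)\<^sup>2)
      \<le> M * (indicator {..<T} t * (\<integral>\<^sup>+s. ennreal (rl_kernel \<gamma> (t - s)) * ennreal ((w s)\<^sup>2) \<partial>lborel))" for t
  proof (cases "t \<in> {0<..<T}")
    case True
    (* The indicator makes the first factor integrable: its square is the kernel on (0,t) only. *)
    let ?f = "\<lambda>s. ennreal (sqrt (rl_kernel \<gamma> (t - s))) * indicator {0<..} s"
    let ?g = "\<lambda>s. ennreal (sqrt (rl_kernel \<gamma> (t - s)) * \<bar>w s\<bar>)"
    have "ennreal \<bar>rl_int \<gamma> w t\<bar> \<le> (\<integral>\<^sup>+s. ennreal (rl_kernel \<gamma> (t - s)) * ennreal \<bar>w s\<bar> \<partial>lborel)"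
      using \<gamma> by (intro abs_rl_int_le) auto
    also have "\<dots> = (\<integral>\<^sup>+s. ?f s * ?g s \<partial>lborel)"
    proof (rule nn_integral_cong)
      fix s show "ennreal (rl_kernel \<gamma> (t - s)) * ennreal \<bar>w s\<bar> = ?f s * ?g s"
        using \<gamma> sq_int_outside[OF w, of s]
        by (cases "s \<le> 0") (auto simp: simp flip: ennreal_mult mult.assoc)
    qed
    finally have "(ennreal \<bar>rl_int \<gamma> w t\<bar>)\<^sup>2 \<le> (\<integral>\<^sup>+s. ?f s * ?g s \<partial>lborel)\<^sup>2"
      by (intro power_mono) auto
    also have "\<dots> \<le> (\<integral>\<^sup>+s. (?f s)\<^sup>2 \<partial>lborel) * (\<integral>\<^sup>+s. (?g s)\<^sup>2 \<partial>lborel)"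
      by (rule Cauchy_Schwarz_nn_integral) auto
    also have "(\<integral>\<^sup>+s. (?f s)\<^sup>2 \<partial>lborel) = (\<integral>\<^sup>+s. ennreal (rl_kernel \<gamma> (t - s) * rl_kernel 1 (s - 0)) \<partial>lborel)"
      using \<gamma> by (intro nn_integral_cong)
        (auto simp: rl_kernel_1 power_mult_distrib ennreal_power indicator_def)
    also have "\<dots> = ennreal (rl_kernel (\<gamma> + 1) (t - 0))"
      using \<gamma> by (intro rl_kernel_convolution) auto
    also have "\<dots> \<le> M" unfolding M_def using True \<gamma> by (intro ennreal_leI rl_kernel_mono) auto
    also have "(\<integral>\<^sup>+s. (?g s)\<^sup>2 \<partial>lborel) = (\<integral>\<^sup>+s. ennreal (rl_kernel \<gamma> (t - s)) * ennreal ((w s)\<^sup>2) \<partial>lborel)"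
      using \<gamma> by (intro nn_integral_cong) (auto simp: ennreal_power power_mult_distrib simp flip: ennreal_mult)
    finally show ?thesis using True by (simp add: cutoff_def ennreal_power mult_right_mono)
  next
    case False
    then have "cutoff T (rl_int \<gamma> w) t = 0" by (simp only: cutoff_def if_False)
    then show ?thesis by simp
  qed
  have "(\<integral>\<^sup>+t. ennreal ((cutoff T (rl_int \<gamma> w) t)\<^sup>2) \<partial>lborel)
     \<le> (\<integral>\<^sup>+t. M * (indicator {..<T} t * (\<integral>\<^sup>+s. ennreal (rl_kernel \<gamma> (t - s)) * ennreal ((w s)\<^sup>2) \<partial>lborel)) \<partial>lborel)"
    by (intro nn_integral_mono pt)
  also have "\<dots> = M * (\<integral>\<^sup>+t. indicator {..<T} t * (\<integral>\<^sup>+s. ennreal (rl_kernel \<gamma> (t - s)) * ennreal ((w s)\<^sup>2) \<partial>lborel) \<partial>lborel)"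
    by (intro nn_integral_cmult) auto
  also have "\<dots> \<le> M * (M * (\<integral>\<^sup>+s. ennreal ((w s)\<^sup>2) \<partial>lborel))"
    unfolding M_def by (intro mult_left_mono rl_nn_integral_le) (use \<gamma> sq_int_outside[OF w] in auto)
  also have "\<dots> < \<infinity>"
    using sq_int_square[OF w] by (auto simp: M_def integrable_iff_bounded ennreal_mult_less_top)
  finally show ?thesis
    unfolding sq_int_def by (auto simp: cutoff_def intro!: integrableI_bounded)
qed

text \<open>Only almost every \<open>t\<close> is covered, because Fubini is applied at the points \<open>t\<close> where the iterated
  integral of \<open>\<bar>w\<bar>\<close> is finite.\<close>
lemma rl_int_semigroup:
  assumes a: "0 \<le> a" and b: "0 \<le> b" and w: "w \<in> sq_int T"
  shows "AE t in lborel. t \<in> {0<..<T} \<longrightarrow> rl_int a (cutoff T (rl_int b w)) t = rl_int (a + b) w t"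
proof -
  consider "a = 0" | "b = 0" | "0 < a" "0 < b" using a b by fastforce
  then show ?thesis
  proof cases
    case 1 then show ?thesis by (simp add: rl_int_def cutoff_def)
  next
    case 2
    then have "cutoff T (rl_int b w) = w"
      using sq_int_outside[OF w] by (auto simp: cutoff_def rl_int_def)
    then show ?thesis using 2 by simp
  next
    case 3
    note [measurable] = sq_int_measurable[OF w]
    have ab: "0 < a + b" using 3 by simp
    show ?thesis using rl_int_finite[OF ab w]
    proof eventually_elim
      case (elim t)
      show ?case
      proof
        assume t: "t \<in> {0<..<T}"
        define f where "f s r = rl_kernel a (t - s) * (rl_kernel b (s - r) * w r)" for s r
        have [measurable]: "(\<lambda>(s, r). f s r) \<in> borel_measurable (lborel \<Otimes>\<^sub>M lborel)"
          unfolding f_def by measurable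
        have "(\<integral>\<^sup>+p. ennreal (norm (case p of (s, r) \<Rightarrow> f s r)) \<partial>(lborel \<Otimes>\<^sub>M lborel))
           = (\<integral>\<^sup>+s. (\<integral>\<^sup>+r. ennreal (norm (f s r)) \<partial>lborel) \<partial>lborel)"
          by (subst lborel.nn_integral_fst[symmetric]) auto
        also have "\<dots> = (\<integral>\<^sup>+s. ennreal (rl_kernel a (t - s)) * (\<integral>\<^sup>+r. ennreal (rl_kernel b (s - r)) * ennreal \<bar>w r\<bar> \<partial>lborel) \<partial>lborel)"
          using 3 by (simp add: f_def abs_mult ennreal_mult nn_integral_cmult)
        also have "\<dots> < \<infinity>"
          using elim t 3 by (subst rl_nn_semigroup) auto
        finally have int: "integrable (lborel \<Otimes>\<^sub>M lborel) (\<lambda>(s, r). f s r)"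
          by (intro integrableI_bounded) auto
        have "rl_int a (cutoff T (rl_int b w)) t = (\<integral>s. rl_kernel a (t - s) * rl_int b w s \<partial>lborel)"
        proof -
          have *: "rl_kernel a (t - s) * cutoff T (rl_int b w) s = rl_kernel a (t - s) * rl_int b w s" for s
            using t rl_int_outside[OF w, of s] by (auto simp: cutoff_def rl_kernel_def)
          have "rl_int a (cutoff T (rl_int b w)) t = (\<integral>s. rl_kernel a (t - s) * cutoff T (rl_int b w) s \<partial>lborel)"
            using 3 by (simp add: rl_int_def)
          then show ?thesis unfolding * .
        qed
        also have "\<dots> = (\<integral>s. (\<integral>r. f s r \<partial>lborel) \<partial>lborel)"
          using 3 by (simp add: f_def rl_int_def)
        also have "\<dots> = (\<integral>r. (\<integral>s. f s r \<partial>lborel) \<partial>lborel)"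
          by (rule lborel_pair.Fubini_integral[OF int, symmetric])
        also have "\<dots> = (\<integral>r. rl_kernel (a + b) (t - r) * w r \<partial>lborel)"
        proof (rule Bochner_Integration.integral_cong)
          fix r
          have "(\<integral>s. f s r \<partial>lborel) = (\<integral>s. rl_kernel a (t - s) * rl_kernel b (s - r) \<partial>lborel) * w r"
            by (simp add: f_def flip: mult.assoc)
          also have "(\<integral>s. rl_kernel a (t - s) * rl_kernel b (s - r) \<partial>lborel) = rl_kernel (a + b) (t - r)"
            using 3 by (subst integral_eq_nn_integral) (auto simp: rl_kernel_convolution)
          finally show "(\<integral>s. f s r \<partial>lborel) = rl_kernel (a + b) (t - r) * w r" .
        qed simp
        also have "\<dots> = rl_int (a + b) w t" using ab by (simp add: rl_int_def)
        finally show "rl_int a (cutoff T (rl_int b w)) t = rl_int (a + b) w t" .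
      qed
    qed
  qed
qed

section \<open>Smooth bump functions\<close>

text \<open>A polynomial in \<open>1/x\<close> times \<open>exp(-1/x)\<close>, extended by \<open>0\<close>: the shape that all derivatives of the
  classical flat function share, which makes smoothness provable by closure under differentiation.\<close>
definition flat :: "real poly \<Rightarrow> real \<Rightarrow> real" where
  "flat p x = (if 0 < x then poly p (1 / x) * exp (- (1 / x)) else 0)"

lemma poly_times_exp_minus_tendsto_0:
  "((\<lambda>y. poly q y * exp (- y)) \<longlongrightarrow> (0::real)) at_top"
proof -
  have "((\<lambda>y. \<Sum>i\<le>degree q. coeff q i * (y ^ i / exp y)) \<longlongrightarrow> (0::real)) at_top"
    by (intro tendsto_null_sum tendsto_mult_right_zero tendsto_power_div_exp_0)
  then show ?thesis
    by (simp add: poly_altdef exp_minus sum_distrib_right divide_inverse mult.assoc)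
qed

lemma flat_has_derivative:
  "(flat p has_real_derivative flat ([:0, 0, 1:] * (p - pderiv p)) x) (at x)"
proof -
  consider "x < 0" | "x = 0" | "0 < x" by linarith
  then show ?thesis
  proof cases
    case 1
    have "((\<lambda>_. 0) has_real_derivative flat ([:0, 0, 1:] * (p - pderiv p)) x) (at x)"
      using 1 by (auto simp: flat_def)
    then show ?thesis
      by (rule has_field_derivative_transform_within_open[where S = "{..<0}"])
         (use 1 in \<open>auto simp: flat_def\<close>)
  next
    case 3
    have "((\<lambda>x. poly p (1 / x) * exp (- (1 / x))) has_real_derivative
            flat ([:0, 0, 1:] * (p - pderiv p)) x) (at x)"
      using 3 by (auto intro!: derivative_eq_intros simp: flat_def field_simps power2_eq_square)
    then show ?thesis
      by (rule has_field_derivative_transform_within_open[where S = "{0<..}"])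
         (use 3 in \<open>auto simp: flat_def\<close>)
  next
    case 2
    have "((\<lambda>h. flat p h / h) \<longlongrightarrow> 0) (at_left 0)"
      by (rule tendsto_eventually) (auto simp: flat_def eventually_at_filter)
    moreover have "((\<lambda>h. flat p h / h) \<longlongrightarrow> 0) (at_right 0)"
    proof (rule Lim_transform_eventually)
      show "((\<lambda>h. poly (pCons 0 p) (inverse h) * exp (- inverse h)) \<longlongrightarrow> 0) (at_right 0)"
        by (rule filterlim_compose[OF poly_times_exp_minus_tendsto_0 filterlim_inverse_at_top_right])
      show "\<forall>\<^sub>F h in at_right 0. poly (pCons 0 p) (inverse h) * exp (- inverse h) = flat p h / h"
        by (auto simp: eventually_at_filter flat_def divide_inverse)
    qed
    ultimately have "((\<lambda>h. flat p h / h) \<longlongrightarrow> 0) (at 0)"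
      by (simp add: filterlim_at_split)
    then show ?thesis using 2 by (simp add: DERIV_def flat_def)
  qed
qed

text \<open>An algebra of functions that is closed under differentiation, and therefore consists of smooth
  functions. It contains the bump functions below without their derivatives having to be computed.\<close>
inductive_set flat_algebra :: "(real \<Rightarrow> real) set" where
  flat: "(\<lambda>x. flat p (c * x + d)) \<in> flat_algebra"
| const: "(\<lambda>x. c) \<in> flat_algebra"
| add: "f \<in> flat_algebra \<Longrightarrow> g \<in> flat_algebra \<Longrightarrow> (\<lambda>x. f x + g x) \<in> flat_algebra"
| mult: "f \<in> flat_algebra \<Longrightarrow> g \<in> flat_algebra \<Longrightarrow> (\<lambda>x. f x * g x) \<in> flat_algebra"

lemma flat_algebra_derivative:
  assumes "f \<in> flat_algebra"
  shows "\<exists>f'\<in>flat_algebra. \<forall>x. (f has_real_derivative f' x) (at x)"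
  using assms
proof induction
  case (flat p c d)
  let ?q = "[:0, 0, 1:] * (p - pderiv p)"
  have "((\<lambda>x. flat p (c * x + d)) has_real_derivative c * flat ?q (c * x + d)) (at x)" for x
  proof -
    have "((\<lambda>x. c * x + d) has_real_derivative c) (at x)"
      by (auto intro!: derivative_eq_intros)
    from DERIV_chain2[OF flat_has_derivative this] show ?thesis by (simp only: mult.commute)
  qed
  moreover have "(\<lambda>x. c * flat ?q (c * x + d)) \<in> flat_algebra"
    by (intro flat_algebra.mult flat_algebra.const flat_algebra.flat)
  ultimately show ?case by (intro bexI[of _ "\<lambda>x. c * flat ?q (c * x + d)"] allI)
next
  case (const c)
  show ?case by (intro bexI[of _ "\<lambda>_. 0"]) (auto intro: flat_algebra.const)
next
  case (add f g)
  then obtain f' g' where "f' \<in> flat_algebra" "g' \<in> flat_algebra"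
    and "\<And>x. (f has_real_derivative f' x) (at x)" "\<And>x. (g has_real_derivative g' x) (at x)" by blast
  then show ?case
    by (intro bexI[of _ "\<lambda>x. f' x + g' x"] allI DERIV_add flat_algebra.add)
next
  case (mult f g)
  then obtain f' g' where "f' \<in> flat_algebra" "g' \<in> flat_algebra"
    and d: "\<And>x. (f has_real_derivative f' x) (at x)" "\<And>x. (g has_real_derivative g' x) (at x)" by blast
  with mult.hyps show ?case
    by (intro bexI[of _ "\<lambda>x. f' x * g x + g' x * f x"] allI DERIV_mult flat_algebra.add flat_algebra.mult d)
qed

lemma flat_algebra_deriv:
  assumes "f \<in> flat_algebra" shows "deriv f \<in> flat_algebra"
proof -
  obtain f' where f': "f' \<in> flat_algebra" "\<And>x. (f has_real_derivative f' x) (at x)"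
    using flat_algebra_derivative[OF assms] by blast
  then have "deriv f = f'" by (auto intro!: DERIV_imp_deriv)
  with f' show ?thesis by simp
qed

lemma flat_algebra_smooth:
  assumes "f \<in> flat_algebra" shows "(deriv ^^ k) f differentiable_on UNIV"
proof -
  have "(deriv ^^ k) f \<in> flat_algebra"
    by (induction k) (auto intro: assms flat_algebra_deriv)
  then show ?thesis
    using flat_algebra_derivative by (fastforce simp: differentiable_on_def real_differentiable_def)
qed

lemma flat_algebra_continuous:
  assumes "f \<in> flat_algebra" shows "continuous_on UNIV f"
  using flat_algebra_smooth[OF assms, of 0] by (simp add: differentiable_imp_continuous_on)

text \<open>Smooth functions supported in \<open>[a,b]\<close> that increase with \<open>n\<close> to the indicator of the open
  interval.\<close>
definition bump :: "real \<Rightarrow> real \<Rightarrow> nat \<Rightarrow> real \<Rightarrow> real" where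
  "bump a b n x = flat 1 (real (Suc n) * (x - a)) * flat 1 (real (Suc n) * (b - x))"

lemma bump_in_flat_algebra: "bump a b n \<in> flat_algebra"
proof -
  have "bump a b n = (\<lambda>x. flat 1 (real (Suc n) * x + - (real (Suc n) * a))
                         * flat 1 (- real (Suc n) * x + real (Suc n) * b))"
    by (rule ext) (simp add: bump_def algebra_simps)
  then show ?thesis by (simp only: flat_algebra.mult flat_algebra.flat)
qed

lemma bump_bounds: "0 \<le> bump a b n x" "bump a b n x \<le> 1"
proof -
  have "0 \<le> flat 1 y \<and> flat 1 y \<le> 1" for y by (simp add: flat_def)
  then show "0 \<le> bump a b n x" "bump a b n x \<le> 1"
    unfolding bump_def by (auto intro!: mult_le_one)
qed

lemma bump_eq_0: "x \<notin> {a<..<b} \<Longrightarrow> bump a b n x = 0"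
  by (auto simp: bump_def flat_def zero_less_mult_iff)

lemma bump_pos: "x \<in> {a<..<b} \<Longrightarrow> 0 < bump a b n x"
  by (auto simp: bump_def flat_def)

lemma bump_measurable [measurable]: "bump a b n \<in> borel_measurable borel"
  by (intro borel_measurable_continuous_onI flat_algebra_continuous bump_in_flat_algebra)

lemma bump_integrable: "integrable lborel (bump a b n)"
proof (rule Bochner_Integration.integrable_bound)
  show "integrable lborel (indicator {a<..<b} :: real \<Rightarrow> real)"
    by (auto intro!: integrable_real_indicator emeasure_bounded_finite)
  show "AE x in lborel. norm (bump a b n x) \<le> norm (indicator {a<..<b} x :: real)"
    using bump_bounds bump_eq_0 by (intro AE_I2) (auto simp: indicator_def)
qed simp

lemma bump_tendsto: "(\<lambda>n. bump a b n x) \<longlonglongrightarrow> indicator {a<..<b} x"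
proof (cases "x \<in> {a<..<b}")
  case True
  have *: "(\<lambda>n. flat 1 (real (Suc n) * y)) \<longlonglongrightarrow> 1" if "0 < y" for y
  proof -
    have "(\<lambda>n. exp (- (inverse (real (Suc n)) * (1 / y)))) \<longlonglongrightarrow> exp (- (0 * (1 / y)))"
      by (intro tendsto_intros LIMSEQ_inverse_real_of_nat)
    moreover have "flat 1 (real (Suc n) * y) = exp (- (inverse (real (Suc n)) * (1 / y)))" for n
      using that by (simp add: flat_def divide_inverse del: of_nat_Suc)
    ultimately show ?thesis by simp
  qed
  have "(\<lambda>n. bump a b n x) \<longlonglongrightarrow> 1 * 1"
    unfolding bump_def using True by (intro tendsto_mult *) auto
  then show ?thesis using True by simp
next
  case False
  then show ?thesis by (simp add: bump_eq_0)
qed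

lemma integral_bump_pos: assumes "a < b" shows "0 < (\<integral>x. bump a b n x \<partial>lborel)"
proof -
  have "(\<integral>x. bump a b n x \<partial>lborel) \<noteq> 0"
  proof
    assume "(\<integral>x. bump a b n x \<partial>lborel) = 0"
    then have "AE x in lborel. bump a b n x = 0"
      by (subst (asm) integral_nonneg_eq_0_iff_AE) (auto simp: bump_bounds bump_integrable)
    then have "AE x in lborel. x \<notin> {a<..<b}"
      by eventually_elim (use bump_pos[of _ a b n] in fastforce)
    then have "{a<..<b} \<in> null_sets lborel"
      by (subst (asm) AE_iff_null_sets[symmetric]) auto
    then show False using assms by (simp add: null_sets_def)
  qed
  moreover have "0 \<le> (\<integral>x. bump a b n x \<partial>lborel)" by (simp add: bump_bounds)
  ultimately show ?thesis by simp
qed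

section \<open>Test functions\<close>

lemma test_fun_deriv:
  assumes "\<phi> \<in> test_fun T" shows "deriv \<phi> \<in> test_fun T"
proof -
  obtain K where K: "compact K" "K \<subseteq> {0<..<T}" "\<And>x. x \<notin> K \<Longrightarrow> \<phi> x = 0"
    and sm: "\<And>k. (deriv ^^ k) \<phi> differentiable_on UNIV"
    using assms by (auto simp: test_fun_def)
  have "deriv \<phi> x = 0" if "x \<notin> K" for x
  proof -
    have "(\<phi> has_real_derivative 0) (at x)"
      by (rule has_field_derivative_transform_within_open[where S = "- K" and f = "\<lambda>_. 0"])
         (use K that in \<open>auto simp: open_Compl compact_imp_closed\<close>)
    then show ?thesis by (rule DERIV_imp_deriv)
  qed
  moreover have "(deriv ^^ k) (deriv \<phi>) differentiable_on UNIV" for k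
    using sm[of "Suc k"] by (simp only: funpow_Suc_right o_apply)
  ultimately show ?thesis using K unfolding test_fun_def by blast
qed

lemma test_fun_funpow_deriv: "\<phi> \<in> test_fun T \<Longrightarrow> (deriv ^^ k) \<phi> \<in> test_fun T"
  by (induction k) (auto intro: test_fun_deriv)

lemma test_fun_has_derivative:
  assumes "\<phi> \<in> test_fun T" shows "(\<phi> has_real_derivative deriv \<phi> x) (at x)"
proof -
  have "\<phi> differentiable_on UNIV"
    using assms unfolding test_fun_def by (auto dest: spec[of _ 0])
  then have "\<phi> differentiable (at x)" by (simp add: differentiable_on_def)
  then show ?thesis using DERIV_deriv_iff_real_differentiable by blast
qed

lemma test_fun_continuous: "\<phi> \<in> test_fun T \<Longrightarrow> continuous_on A \<phi>"
  by (meson DERIV_isCont continuous_at_imp_continuous_on test_fun_has_derivative)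

lemma test_fun_measurable: "\<phi> \<in> test_fun T \<Longrightarrow> \<phi> \<in> borel_measurable borel"
  by (intro borel_measurable_continuous_onI test_fun_continuous)

lemma test_fun_outside: "\<phi> \<in> test_fun T \<Longrightarrow> t \<notin> {0<..<T} \<Longrightarrow> \<phi> t = 0"
  unfolding test_fun_def by blast

lemma test_fun_bounded: assumes "\<phi> \<in> test_fun T" obtains C where "\<And>t. \<bar>\<phi> t\<bar> \<le> C"
proof -
  obtain K where K: "compact K" "\<And>x. x \<notin> K \<Longrightarrow> \<phi> x = 0"
    using assms by (auto simp: test_fun_def)
  have "bounded (\<phi> ` K)"
    using K test_fun_continuous[OF assms] by (intro compact_imp_bounded compact_continuous_image)
  then obtain C where C: "\<And>x. x \<in> K \<Longrightarrow> \<bar>\<phi> x\<bar> \<le> C" by (auto simp: bounded_real)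
  have "\<bar>\<phi> t\<bar> \<le> max C 0" for t using C[of t] K(2)[of t] by (cases "t \<in> K") auto
  then show ?thesis by (rule that)
qed

lemma bounded_sq_int:
  assumes [measurable]: "f \<in> borel_measurable borel"
    and C: "\<And>t. \<bar>f t\<bar> \<le> C" and out: "\<And>t. t \<notin> {0<..<T} \<Longrightarrow> f t = 0"
  shows "f \<in> sq_int T"
proof -
  have "integrable lborel (\<lambda>t. (f t)\<^sup>2)"
  proof (rule Bochner_Integration.integrable_bound)
    show "integrable lborel (\<lambda>t. C\<^sup>2 * indicator {0<..<T} t)"
      by (auto intro!: integrable_real_indicator emeasure_bounded_finite)
    show "AE t in lborel. norm ((f t)\<^sup>2) \<le> norm (C\<^sup>2 * indicator {0<..<T} t)"
    proof (rule AE_I2)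
      fix t show "norm ((f t)\<^sup>2) \<le> norm (C\<^sup>2 * indicator {0<..<T} t)"
        using C[of t] out[of t] power_mono[OF C[of t], of 2] by (cases "t \<in> {0<..<T}") auto
    qed
  qed simp
  then show ?thesis using out by (auto simp: sq_int_def)
qed

lemma test_fun_sq_int: "\<phi> \<in> test_fun T \<Longrightarrow> \<phi> \<in> sq_int T"
  by (metis bounded_sq_int test_fun_bounded test_fun_measurable test_fun_outside)

lemma rl_int_1: "rl_int 1 f t = (\<integral>s. f s * indicator {..<t} s \<partial>lborel)"
  unfolding rl_int_def by (auto simp: rl_kernel_1 indicator_def intro!: Bochner_Integration.integral_cong)

text \<open>Presenting a test function as a primitive allows the product rule for primitives to serve as
  integration by parts.\<close>
lemma test_fun_eq_rl_int_1:
  assumes \<phi>: "\<phi> \<in> test_fun T" shows "\<phi> t = rl_int 1 (deriv \<phi>) t"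
proof -
  let ?a = "min 0 t"
  have "(\<integral>s. deriv \<phi> s * indicator {?a..t} s \<partial>lborel) = \<phi> t - \<phi> ?a"
    using test_fun_has_derivative[OF \<phi>] test_fun_continuous[OF test_fun_deriv[OF \<phi>], of UNIV]
    by (intro integral_FTC_Icc_real) (auto simp: continuous_on_eq_continuous_at)
  also have "\<phi> ?a = 0" using test_fun_outside[OF \<phi>] by auto
  also have "(\<integral>s. deriv \<phi> s * indicator {?a..t} s \<partial>lborel) = (\<integral>s. deriv \<phi> s * indicator {..<t} s \<partial>lborel)"
  proof (rule integral_cong_AE)
    have [measurable]: "deriv \<phi> \<in> borel_measurable borel"
      by (rule test_fun_measurable[OF test_fun_deriv[OF \<phi>]])
    show "AE s in lborel. deriv \<phi> s * indicator {?a..t} s = deriv \<phi> s * indicator {..<t} s"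
      using AE_lborel_singleton[of t]
    proof eventually_elim
      case (elim s)
      then show ?case
        using test_fun_outside[OF test_fun_deriv[OF \<phi>], of s]
        by (cases "s \<le> 0") (auto simp: indicator_def)
    qed
  qed (use test_fun_measurable[OF test_fun_deriv[OF \<phi>]] in measurable)
  finally show ?thesis by (simp add: rl_int_1)
qed

section \<open>Products of primitives\<close>

lemma integrable_mult_indicator_lessThan: "integrable lborel f \<Longrightarrow> integrable lborel (\<lambda>s. f s * indicator {..<t::real} s :: real)"
  using integrable_real_mult_indicator[of "{..<t}" lborel f] by simp

lemma abs_rl_int_1_le:
  assumes "integrable lborel f" shows "\<bar>rl_int 1 f t\<bar> \<le> (\<integral>s. \<bar>f s\<bar> \<partial>lborel)"
proof -
  have "\<bar>rl_int 1 f t\<bar> \<le> (\<integral>s. \<bar>f s * indicator {..<t} s\<bar> \<partial>lborel)"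
    unfolding rl_int_1 by (rule integral_abs_bound)
  also have "\<dots> \<le> (\<integral>s. \<bar>f s\<bar> \<partial>lborel)"
    using assms by (intro integral_mono integrable_abs integrable_mult_indicator_lessThan) (auto simp: indicator_def)
  finally show ?thesis .
qed

lemma integrable_bounded_mult:
  fixes f g :: "real \<Rightarrow> real"
  assumes [measurable]: "f \<in> borel_measurable borel" and C: "\<And>x. \<bar>f x\<bar> \<le> C" and g: "integrable lborel g"
  shows "integrable lborel (\<lambda>x. f x * g x)"
proof (rule Bochner_Integration.integrable_bound)
  have [measurable]: "g \<in> borel_measurable borel" using borel_measurable_integrable[OF g] by simp
  show "integrable lborel (\<lambda>x. C * g x)" using g by simp
  have "\<bar>f x\<bar> \<le> \<bar>C\<bar>" for x using C[of x] by linarith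
  then show "AE x in lborel. norm (f x * g x) \<le> norm (C * g x)"
    by (intro AE_I2) (simp add: abs_mult mult_right_mono)
  show "(\<lambda>x. f x * g x) \<in> borel_measurable lborel" by simp
qed

lemma integrable_mult_rl_int_1:
  assumes f: "integrable lborel f" and g: "integrable lborel g"
  shows "integrable lborel (\<lambda>s. f s * rl_int 1 g s)"
proof -
  have [measurable]: "g \<in> borel_measurable borel" using borel_measurable_integrable[OF g] by simp
  show ?thesis
    using integrable_bounded_mult[OF _ abs_rl_int_1_le[OF g] f] by (simp add: mult.commute)
qed

text \<open>Integration by parts for primitives of merely integrable functions: the product is an integral
  over the square \<open>(-\<infinity>,t)\<^sup>2\<close>, which the diagonal splits into two triangles, and Fubini evaluates each
  of them in the convenient order. The function \<open>q\<close> in the proof is the integrand on the triangle \<open>s < r < t\<close>.\<close>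
lemma rl_int_1_product:
  assumes f: "integrable lborel f" and g: "integrable lborel g"
  shows "rl_int 1 f t * rl_int 1 g t = rl_int 1 (\<lambda>s. f s * rl_int 1 g s + rl_int 1 f s * g s) t"
proof -
  have [measurable]: "f \<in> borel_measurable borel" "g \<in> borel_measurable borel"
    using f g by (auto dest: borel_measurable_integrable)
  define q where "q s r = f s * g r * indicator {..<t} r * indicator {..<r} s" for s r
  have [measurable]: "(\<lambda>(s, r). q s r) \<in> borel_measurable (lborel \<Otimes>\<^sub>M lborel)"
    unfolding q_def indicator_def lessThan_iff by measurable
  have int: "integrable (lborel \<Otimes>\<^sub>M lborel) (\<lambda>(s, r). q s r)"
  proof (rule integrableI_bounded)
    have "(\<integral>\<^sup>+p. ennreal (norm (case p of (s, r) \<Rightarrow> q s r)) \<partial>(lborel \<Otimes>\<^sub>M lborel))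
       = (\<integral>\<^sup>+s. (\<integral>\<^sup>+r. ennreal (norm (q s r)) \<partial>lborel) \<partial>lborel)"
      by (subst lborel.nn_integral_fst[symmetric]) auto
    also have "\<dots> \<le> (\<integral>\<^sup>+s. (\<integral>\<^sup>+r. ennreal \<bar>f s\<bar> * ennreal \<bar>g r\<bar> \<partial>lborel) \<partial>lborel)"
      by (intro nn_integral_mono) (auto simp: q_def abs_mult indicator_def simp flip: ennreal_mult)
    also have "\<dots> = (\<integral>\<^sup>+s. ennreal \<bar>f s\<bar> \<partial>lborel) * (\<integral>\<^sup>+r. ennreal \<bar>g r\<bar> \<partial>lborel)"
      by (simp add: nn_integral_cmult nn_integral_multc)
    also have "\<dots> < \<infinity>" using f g by (auto simp: integrable_iff_bounded ennreal_mult_less_top)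
    finally show "(\<integral>\<^sup>+p. ennreal (norm (case p of (s, r) \<Rightarrow> q s r)) \<partial>(lborel \<Otimes>\<^sub>M lborel)) < \<infinity>" .
  qed simp
  have "rl_int 1 f t * rl_int 1 g t = (\<integral>s. f s * indicator {..<t} s * rl_int 1 g t \<partial>lborel)"
    by (simp add: rl_int_1)
  also have "\<dots> = (\<integral>s. f s * rl_int 1 g s * indicator {..<t} s + (\<integral>r. q s r \<partial>lborel) \<partial>lborel)"
  proof (rule Bochner_Integration.integral_cong)
    fix s
    show "f s * indicator {..<t} s * rl_int 1 g t
        = f s * rl_int 1 g s * indicator {..<t} s + (\<integral>r. q s r \<partial>lborel)"
    proof (cases "s < t")
      case True
      have "rl_int 1 g t = (\<integral>r. g r * indicator {..<s} r + g r * indicator {..<t} r * indicator {..<r} s \<partial>lborel)"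
        unfolding rl_int_1
      proof (rule integral_cong_AE)
        show "AE r in lborel. g r * indicator {..<t} r
            = g r * indicator {..<s} r + g r * indicator {..<t} r * indicator {..<r} s"
          using AE_lborel_singleton[of s] by eventually_elim (use True in \<open>auto simp: indicator_def\<close>)
      qed (unfold indicator_def lessThan_iff, measurable)
      also have "\<dots> = rl_int 1 g s + (\<integral>r. g r * indicator {..<t} r * indicator {..<r} s \<partial>lborel)"
        unfolding rl_int_1
      proof (intro Bochner_Integration.integral_add integrable_mult_indicator_lessThan g)
        show "integrable lborel (\<lambda>r. g r * indicator {..<t} r * indicator {..<r} s)"
          by (rule Bochner_Integration.integrable_bound[OF g])
             (auto simp: indicator_def cong: if_cong)
      qed
      finally show ?thesis using True by (simp add: q_def algebra_simps)
    next
      case False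
      then have "q s r = 0" for r by (auto simp: q_def indicator_def)
      then show ?thesis using False by simp
    qed
  qed simp
  also have "\<dots> = (\<integral>s. f s * rl_int 1 g s * indicator {..<t} s \<partial>lborel) + (\<integral>s. (\<integral>r. q s r \<partial>lborel) \<partial>lborel)"
    using lborel_pair.integrable_fst'[OF int]
    by (intro Bochner_Integration.integral_add integrable_mult_indicator_lessThan integrable_mult_rl_int_1 f g) simp
  also have "(\<integral>s. (\<integral>r. q s r \<partial>lborel) \<partial>lborel) = (\<integral>r. (\<integral>s. q s r \<partial>lborel) \<partial>lborel)"
    by (rule lborel_pair.Fubini_integral[OF int, symmetric])
  also have "\<dots> = (\<integral>r. rl_int 1 f r * g r * indicator {..<t} r \<partial>lborel)"
  proof (rule Bochner_Integration.integral_cong)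
    fix r
    have "(\<integral>s. q s r \<partial>lborel) = (\<integral>s. (g r * indicator {..<t} r) * (f s * indicator {..<r} s) \<partial>lborel)"
      by (simp add: q_def mult_ac)
    also have "\<dots> = (g r * indicator {..<t} r) * rl_int 1 f r"
      unfolding rl_int_1 by (rule integral_mult_right_zero)
    finally show "(\<integral>s. q s r \<partial>lborel) = rl_int 1 f r * g r * indicator {..<t} r"
      by (simp add: mult_ac)
  qed simp
  also have "(\<integral>s. f s * rl_int 1 g s * indicator {..<t} s \<partial>lborel) + \<dots>
      = rl_int 1 (\<lambda>s. f s * rl_int 1 g s + rl_int 1 f s * g s) t"
    unfolding rl_int_1[of "\<lambda>s. f s * rl_int 1 g s + rl_int 1 f s * g s"] distrib_right
    using integrable_mult_rl_int_1[OF g f]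
    by (intro Bochner_Integration.integral_add[symmetric] integrable_mult_indicator_lessThan integrable_mult_rl_int_1 f g)
       (simp add: mult.commute)
  finally show ?thesis .
qed

section \<open>The lemma of du Bois-Reymond\<close>

text \<open>A smooth function with compact support is the derivative of a test function as soon as its
  integral is \<open>0\<close>, since the antiderivative from the left then vanishes again on the right.\<close>
lemma test_fun_antiderivative:
  assumes g: "g \<in> flat_algebra" and ab: "0 < a" "b < T"
    and out: "\<And>x. x \<notin> {a..b} \<Longrightarrow> g x = 0" and 0: "(\<integral>x. g x \<partial>lborel) = 0"
  shows "\<exists>\<phi>\<in>test_fun T. deriv \<phi> = g"
proof -
  have cont: "continuous_on UNIV g" by (rule flat_algebra_continuous[OF g])
  then have "isCont g x" for x by (simp add: continuous_on_eq_continuous_at)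
  then obtain G where "\<And>x. (G has_vector_derivative g x) (at x)"
    using einterval_antiderivative[of "-\<infinity>" "\<infinity>" g] by auto
  then have G: "(G has_real_derivative g x) (at x)" for x
    by (simp add: has_real_derivative_iff_has_vector_derivative)
  define \<phi> where "\<phi> x = G x - G 0" for x
  have \<phi>: "(\<phi> has_real_derivative g x) (at x)" for x
    unfolding \<phi>_def by (auto intro!: derivative_eq_intros G)
  have FTC: "\<phi> y - \<phi> x = (\<integral>s. g s * indicator {x..y} s \<partial>lborel)" if "x \<le> y" for x y
    using that \<phi> \<open>\<And>x. isCont g x\<close> by (intro integral_FTC_Icc_real[symmetric]) auto
  have "\<phi> x = 0" if "x \<notin> {a..b}" for x
  proof -
    consider "x \<le> 0" | "0 \<le> x" "x < a" | "0 \<le> x" "b < x" using \<open>x \<notin> {a..b}\<close> by fastforce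
    then show ?thesis
    proof cases
      case 1
      then have *: "g s * indicator {x..0} s = 0" for s using out[of s] ab by (auto simp: indicator_def)
      show ?thesis using FTC[OF 1] unfolding * by (simp add: \<phi>_def)
    next
      case 2
      then have *: "g s * indicator {0..x} s = 0" for s using out[of s] ab by (auto simp: indicator_def)
      show ?thesis using FTC[OF 2(1)] unfolding * by (simp add: \<phi>_def)
    next
      case 3
      then have *: "g s * indicator {0..x} s = g s" for s
        using out[of s] ab by (cases "s \<in> {a..b}") (auto simp: indicator_def)
      show ?thesis using FTC[OF 3(1)] 0 unfolding * by (simp add: \<phi>_def)
    qed
  qed
  moreover have d: "deriv \<phi> = g" using \<phi> by (auto intro!: DERIV_imp_deriv)
  moreover have "(deriv ^^ k) \<phi> differentiable_on UNIV" for k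
  proof (cases k)
    case 0
    then show ?thesis using \<phi> by (auto simp: differentiable_on_def real_differentiable_def)
  next
    case (Suc n)
    then show ?thesis using flat_algebra_smooth[OF g, of n] by (simp only: funpow_Suc_right o_apply d)
  qed
  ultimately have "\<phi> \<in> test_fun T"
    using ab unfolding test_fun_def by (auto intro!: exI[of _ "{a..b}"])
  then show ?thesis using d by blast
qed

text \<open>Lebesgue's differentiation theorem: almost everywhere the value is the limit of the means over
  small intervals, and these means are \<open>0\<close>.\<close>
lemma integral_intervals_0_imp_AE_0:
  fixes f :: "real \<Rightarrow> real"
  assumes f: "integrable lborel f"
    and 0: "\<And>a b. 0 < a \<Longrightarrow> a < b \<Longrightarrow> b < T \<Longrightarrow> (\<integral>x. f x * indicator {a<..<b} x \<partial>lborel) = 0"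
  shows "AE x in lborel. x \<in> {0<..<T} \<longrightarrow> f x = 0"
proof -
  have si: "set_integrable lborel A f" if "A \<in> sets borel" for A
    using f that unfolding set_integrable_def by (intro integrable_mult_indicator) auto
  have "f integrable_on cbox a b" for a b
    by (rule set_borel_integral_eq_integral(1)[OF si]) simp
  then obtain N where N: "negligible N" and lim:
    "\<And>x e. \<lbrakk>x \<notin> N; 0 < e\<rbrakk> \<Longrightarrow> \<exists>d>0. \<forall>h. 0 < h \<and> h < d \<longrightarrow>
        norm (integral (cbox x (x + h *\<^sub>R One)) f /\<^sub>R h ^ DIM(real) - f x) < e"
    using integrable_ccontinuous_explicit[of f] by blast
  have "f x = 0" if x: "x \<notin> N" "x \<in> {0<..<T}" for x
  proof (rule ccontr)
    assume "f x \<noteq> 0"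
    then have "0 < \<bar>f x\<bar>" by simp
    from lim[OF x(1) this] obtain d where "0 < d" and d:
      "\<And>h. 0 < h \<Longrightarrow> h < d \<Longrightarrow> norm (integral (cbox x (x + h *\<^sub>R One)) f /\<^sub>R h ^ DIM(real) - f x) < \<bar>f x\<bar>"
      by blast
    define h where "h = min (d / 2) ((T - x) / 2)"
    have h: "0 < h" "h < d" "x + h < T" using x \<open>0 < d\<close> by (auto simp: h_def min_def field_simps)
    have "integral {x..x + h} f = integral {x<..<x + h} f" by (rule integral_open_interval_real)
    also have "\<dots> = (LINT y:{x<..<x + h}|lborel. f y)"
      by (rule set_borel_integral_eq_integral(2)[OF si, symmetric]) simp
    also have "\<dots> = 0" using 0[of x "x + h"] h x by (simp add: set_lebesgue_integral_def mult.commute)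
    finally show False using d[OF h(1,2)] by simp
  qed
  moreover have "AE x in lebesgue. x \<notin> N"
    using N by (intro AE_not_in) (simp add: negligible_iff_null_sets)
  then have "AE x in lborel. x \<notin> N" by (simp add: AE_completion_iff)
  ultimately show ?thesis by auto
qed

text \<open>Fix one bump \<open>\<psi>\<close> with integral \<open>I\<close>. Every other bump differs from a multiple of \<open>\<psi>\<close> by the
  derivative of a test function, so testing \<open>Q\<close> against it gives a constant \<open>c\<close> times its integral, \<open>c\<close>
  being the value found for \<open>\<psi>\<close>. Letting the bumps tend to indicators, \<open>Q - c\<close> has integral \<open>0\<close> over
  every subinterval.\<close>
lemma du_Bois_Reymond:
  assumes T: "0 < T" and [measurable]: "Q \<in> borel_measurable borel"
    and C: "\<And>x. \<bar>Q x\<bar> \<le> C"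
    and weak: "\<And>\<phi>. \<phi> \<in> test_fun T \<Longrightarrow> (\<integral>x. Q x * deriv \<phi> x \<partial>lborel) = 0"
  shows "\<exists>c. AE x in lborel. x \<in> {0<..<T} \<longrightarrow> Q x = c"
proof -
  define \<psi> where "\<psi> = bump (T / 4) (T / 2) 0"
  define I where "I = (\<integral>x. \<psi> x \<partial>lborel)"
  define c where "c = (\<integral>x. Q x * \<psi> x \<partial>lborel) / I"
  have I: "0 < I" unfolding I_def \<psi>_def using T by (intro integral_bump_pos) auto
  have Qint: "integrable lborel (\<lambda>x. Q x * bump a b n x)" for a b n
    using C by (intro integrable_bounded_mult bump_integrable) auto
  have bump: "(\<integral>x. Q x * bump a b n x \<partial>lborel) = c * (\<integral>x. bump a b n x \<partial>lborel)"
    if ab: "0 < a" "a < b" "b < T" for a b n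
  proof -
    define k where "k = (\<integral>x. bump a b n x \<partial>lborel) / I"
    define g where "g x = bump a b n x + (- k) * \<psi> x" for x
    have "\<exists>\<phi>\<in>test_fun T. deriv \<phi> = g"
    proof (rule test_fun_antiderivative)
      show "g \<in> flat_algebra" unfolding g_def[abs_def] \<psi>_def
        by (intro flat_algebra.add flat_algebra.mult flat_algebra.const bump_in_flat_algebra)
      show "0 < min a (T / 4)" "max b (T / 2) < T" using ab T by auto
      show "g x = 0" if "x \<notin> {min a (T / 4)..max b (T / 2)}" for x
      proof -
        have "x \<notin> {a<..<b}" "x \<notin> {T / 4<..<T / 2}" using that by auto
        then show ?thesis by (simp add: g_def \<psi>_def bump_eq_0 del: greaterThanLessThan_iff)
      qed
      have "(\<integral>x. g x \<partial>lborel) = (\<integral>x. bump a b n x \<partial>lborel) + (- k) * I"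
        unfolding g_def I_def \<psi>_def by (simp add: bump_integrable)
      then show "(\<integral>x. g x \<partial>lborel) = 0" using I by (simp add: k_def)
    qed
    then have "0 = (\<integral>x. Q x * g x \<partial>lborel)" using weak by metis
    also have "\<dots> = (\<integral>x. Q x * bump a b n x + (- k) * (Q x * \<psi> x) \<partial>lborel)"
      by (simp add: g_def algebra_simps)
    also have "\<dots> = (\<integral>x. Q x * bump a b n x \<partial>lborel) + (- k) * (\<integral>x. Q x * \<psi> x \<partial>lborel)"
      using Qint unfolding \<psi>_def by (subst Bochner_Integration.integral_add) auto
    finally show ?thesis using I by (simp add: k_def c_def field_simps)
  qed
  define f where "f x = (Q x - c) * indicator {0<..<T} x" for x
  have "integrable lborel f"
  proof (rule Bochner_Integration.integrable_bound)
    show "integrable lborel (\<lambda>x. (C + \<bar>c\<bar>) * indicator {0<..<T} x)"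
      by (auto intro!: integrable_real_indicator emeasure_bounded_finite)
    have "\<bar>Q x - c\<bar> \<le> C + \<bar>c\<bar>" for x using C[of x] by linarith
    then show "AE x in lborel. norm (f x) \<le> norm ((C + \<bar>c\<bar>) * indicator {0<..<T} x)"
      by (intro AE_I2) (auto simp: f_def indicator_def intro: order_trans[OF _ abs_ge_self])
  qed (simp add: f_def[abs_def])
  then have "AE x in lborel. x \<in> {0<..<T} \<longrightarrow> f x = 0"
  proof (rule integral_intervals_0_imp_AE_0)
    fix a b assume ab: "0 < a" "a < b" "b < T"
    have ind: "integrable lborel (\<lambda>x. K * indicator {a<..<b} x)" for K :: real
      by (auto intro!: integrable_real_indicator emeasure_bounded_finite)
    have "(\<lambda>n. \<integral>x. (Q x - c) * bump a b n x \<partial>lborel) \<longlonglongrightarrow> (\<integral>x. (Q x - c) * indicator {a<..<b} x \<partial>lborel)"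
    proof (rule integral_dominated_convergence[where w = "\<lambda>x. (C + \<bar>c\<bar>) * indicator {a<..<b} x"])
      show "AE x in lborel. (\<lambda>n. (Q x - c) * bump a b n x) \<longlonglongrightarrow> (Q x - c) * indicator {a<..<b} x"
        by (intro AE_I2 tendsto_intros bump_tendsto)
      fix n
      have "\<bar>Q x - c\<bar> * \<bar>bump a b n x\<bar> \<le> (C + \<bar>c\<bar>) * indicator {a<..<b} x" for x
      proof (cases "x \<in> {a<..<b}")
        case True
        have "\<bar>Q x - c\<bar> * \<bar>bump a b n x\<bar> \<le> (C + \<bar>c\<bar>) * 1"
          using C[of x] bump_bounds[of a b n x] by (intro mult_mono) linarith+
        then show ?thesis using True by simp
      qed (simp add: bump_eq_0)
      then show "AE x in lborel. norm ((Q x - c) * bump a b n x) \<le> (C + \<bar>c\<bar>) * indicator {a<..<b} x"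
        by (intro AE_I2) (simp add: abs_mult)
    qed (use ind in simp_all)
    moreover have "(\<integral>x. (Q x - c) * bump a b n x \<partial>lborel) = 0" for n
      using bump[OF ab, of n] Qint bump_integrable by (simp add: left_diff_distrib)
    ultimately have "(\<integral>x. (Q x - c) * indicator {a<..<b} x \<partial>lborel) = 0"
      by (simp add: LIMSEQ_const_iff)
    also have "(\<integral>x. (Q x - c) * indicator {a<..<b} x \<partial>lborel) = (\<integral>x. f x * indicator {a<..<b} x \<partial>lborel)"
      using ab by (intro Bochner_Integration.integral_cong) (auto simp: f_def indicator_def)
    finally show "(\<integral>x. f x * indicator {a<..<b} x \<partial>lborel) = 0" .
  qed
  then show ?thesis by (intro exI[of _ c]) (auto simp: f_def)
qed

text \<open>Integration by parts shows that the primitive of \<open>g\<close> has the same weak derivative as \<open>f\<close>, so that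
  their difference is constant by the lemma of du Bois-Reymond.\<close>
lemma primitive_of_weak_derivative:
  assumes T: "0 < T" and f: "f \<in> borel_measurable borel" "\<And>t. \<bar>f t\<bar> \<le> C"
    and g: "g \<in> sq_int T"
    and weak: "\<And>\<phi>. \<phi> \<in> test_fun T \<Longrightarrow> (\<integral>t. f t * deriv \<phi> t \<partial>lborel) = - (\<integral>t. g t * \<phi> t \<partial>lborel)"
  shows "\<exists>c. AE t in lborel. t \<in> {0<..<T} \<longrightarrow> f t = c + rl_int 1 g t"
proof -
  note [measurable] = f(1) sq_int_measurable[OF g]
  have gi: "integrable lborel g" by (rule sq_int_integrable[OF g])
  define K where "K = (\<integral>s. \<bar>g s\<bar> \<partial>lborel)"
  have "\<exists>c. AE t in lborel. t \<in> {0<..<T} \<longrightarrow> f t - rl_int 1 g t = c"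
  proof (rule du_Bois_Reymond[OF T])
    show "\<bar>f t - rl_int 1 g t\<bar> \<le> C + K" for t
      using f(2)[of t] abs_rl_int_1_le[OF gi, of t] unfolding K_def by linarith
    fix \<phi> assume \<phi>: "\<phi> \<in> test_fun T"
    note \<phi>' = test_fun_deriv[OF \<phi>]
    note [measurable] = test_fun_measurable[OF \<phi>'] test_fun_measurable[OF \<phi>]
    have di: "integrable lborel (deriv \<phi>)" by (rule sq_int_integrable[OF test_fun_sq_int[OF \<phi>']])
    have i1: "integrable lborel (\<lambda>t. f t * deriv \<phi> t)"
      by (rule integrable_bounded_mult[OF f di])
    have i2: "integrable lborel (\<lambda>t. deriv \<phi> t * rl_int 1 g t)"
      by (rule integrable_mult_rl_int_1[OF di gi])
    have i3: "integrable lborel (\<lambda>t. g t * \<phi> t)"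
      using integrable_mult_rl_int_1[OF gi di] by (simp flip: test_fun_eq_rl_int_1[OF \<phi>])
    (* Integration by parts up to T, where the boundary term vanishes with the test function. *)
    have "0 = rl_int 1 g T * \<phi> T" using test_fun_outside[OF \<phi>, of T] by simp
    also have "\<dots> = rl_int 1 (\<lambda>t. g t * \<phi> t + rl_int 1 g t * deriv \<phi> t) T"
      using rl_int_1_product[OF gi di, of T] by (simp flip: test_fun_eq_rl_int_1[OF \<phi>])
    also have "\<dots> = (\<integral>t. g t * \<phi> t + rl_int 1 g t * deriv \<phi> t \<partial>lborel)"
      unfolding rl_int_1[of "\<lambda>t. g t * \<phi> t + rl_int 1 g t * deriv \<phi> t"]
      using test_fun_outside[OF \<phi>] test_fun_outside[OF \<phi>']
      by (intro Bochner_Integration.integral_cong) (auto simp: indicator_def)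
    also have "\<dots> = (\<integral>t. g t * \<phi> t \<partial>lborel) + (\<integral>t. rl_int 1 g t * deriv \<phi> t \<partial>lborel)"
      using i2 i3 by (simp add: mult.commute)
    finally show "(\<integral>t. (f t - rl_int 1 g t) * deriv \<phi> t \<partial>lborel) = 0"
      using weak[OF \<phi>] i1 i2 by (simp add: algebra_simps)
  qed simp
  then obtain c where "AE t in lborel. t \<in> {0<..<T} \<longrightarrow> f t - rl_int 1 g t = c" by blast
  then have "AE t in lborel. t \<in> {0<..<T} \<longrightarrow> f t = c + rl_int 1 g t"
    by eventually_elim auto
  then show ?thesis by blast
qed

section \<open>The scale of fractional spaces\<close>

text \<open>The space \<open>H\<^sub>\<gamma>(0,T)\<close>, for \<open>\<gamma> = 0\<close> equal to \<open>L\<^sup>2(0,T)\<close>.\<close>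
definition rl_space :: "real \<Rightarrow> real \<Rightarrow> (real \<Rightarrow> real) set" where
  "rl_space \<gamma> T = {v. \<exists>w\<in>sq_int T. AE t in lborel. t \<in> {0<..<T} \<longrightarrow> v t = rl_int \<gamma> w t}"

lemma rl_space_cong:
  assumes "v \<in> rl_space \<gamma> T" "AE t in lborel. t \<in> {0<..<T} \<longrightarrow> v' t = v t"
  shows "v' \<in> rl_space \<gamma> T"
proof -
  obtain w where "w \<in> sq_int T" and w: "AE t in lborel. t \<in> {0<..<T} \<longrightarrow> v t = rl_int \<gamma> w t"
    using assms(1) by (auto simp: rl_space_def)
  moreover have "AE t in lborel. t \<in> {0<..<T} \<longrightarrow> v' t = rl_int \<gamma> w t"
    using w assms(2) by eventually_elim auto
  ultimately show ?thesis by (auto simp: rl_space_def)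
qed

lemma rl_int_AE_cong:
  assumes [measurable]: "v \<in> borel_measurable borel" "w \<in> borel_measurable borel"
    and eq: "AE s in lborel. v s = w s"
  shows "AE t in lborel. rl_int \<gamma> v t = rl_int \<gamma> w t"
proof (cases "\<gamma> = 0")
  case True then show ?thesis using eq by (simp add: rl_int_def)
next
  case False
  have "(\<integral>s. rl_kernel \<gamma> (t - s) * v s \<partial>lborel) = (\<integral>s. rl_kernel \<gamma> (t - s) * w s \<partial>lborel)" for t
    by (rule integral_cong_AE) (use eq in auto)
  then show ?thesis using False by (simp add: rl_int_def)
qed

lemma sq_int_add:
  assumes v: "v \<in> sq_int T" and w: "w \<in> sq_int T" shows "(\<lambda>t. v t + w t) \<in> sq_int T"
proof -
  note [measurable] = sq_int_measurable[OF v] sq_int_measurable[OF w]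
  have "integrable lborel (\<lambda>t. (v t + w t)\<^sup>2)"
  proof (rule Bochner_Integration.integrable_bound)
    show "integrable lborel (\<lambda>t. 2 * (v t)\<^sup>2 + 2 * (w t)\<^sup>2)"
      using sq_int_square[OF v] sq_int_square[OF w] by simp
    have "(v t + w t)\<^sup>2 \<le> 2 * (v t)\<^sup>2 + 2 * (w t)\<^sup>2" for t
      using zero_le_power2[of "v t - w t"] by (simp add: power2_eq_square algebra_simps)
    then show "AE t in lborel. norm ((v t + w t)\<^sup>2) \<le> norm (2 * (v t)\<^sup>2 + 2 * (w t)\<^sup>2)"
      by (intro AE_I2) simp
  qed simp
  then show ?thesis using sq_int_outside[OF v] sq_int_outside[OF w] by (auto simp: sq_int_def)
qed

lemma sq_int_bounded_mult:
  assumes [measurable]: "f \<in> borel_measurable borel" and C: "\<And>x. \<bar>f x\<bar> \<le> C" and w: "w \<in> sq_int T"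
  shows "(\<lambda>t. f t * w t) \<in> sq_int T"
proof -
  note [measurable] = sq_int_measurable[OF w]
  have "\<bar>(f x)\<^sup>2\<bar> \<le> C\<^sup>2" for x using power_mono[OF C[of x], of 2] by simp
  then have "integrable lborel (\<lambda>t. (f t)\<^sup>2 * (w t)\<^sup>2)"
    by (intro integrable_bounded_mult sq_int_square[OF w]) auto
  then show ?thesis using sq_int_outside[OF w] by (auto simp: sq_int_def power_mult_distrib)
qed

lemma rl_space_add:
  assumes "0 \<le> \<gamma>" "u \<in> rl_space \<gamma> T" "v \<in> rl_space \<gamma> T"
  shows "(\<lambda>t. u t + v t) \<in> rl_space \<gamma> T"
proof -
  obtain f g where f: "f \<in> sq_int T" "AE t in lborel. t \<in> {0<..<T} \<longrightarrow> u t = rl_int \<gamma> f t"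
    and g: "g \<in> sq_int T" "AE t in lborel. t \<in> {0<..<T} \<longrightarrow> v t = rl_int \<gamma> g t"
    using assms by (auto simp: rl_space_def)
  have "AE t in lborel. t \<in> {0<..<T} \<longrightarrow> rl_int \<gamma> (\<lambda>s. f s + g s) t = rl_int \<gamma> f t + rl_int \<gamma> g t"
  proof (cases "\<gamma> = 0")
    case True then show ?thesis by (simp add: rl_int_def)
  next
    case False
    with assms have \<gamma>: "0 < \<gamma>" by simp
    show ?thesis using rl_int_integrable[OF \<gamma> f(1)] rl_int_integrable[OF \<gamma> g(1)]
      by eventually_elim (use \<gamma> in \<open>auto simp: rl_int_def distrib_left\<close>)
  qed
  with f(2) g(2) have "AE t in lborel. t \<in> {0<..<T} \<longrightarrow> u t + v t = rl_int \<gamma> (\<lambda>s. f s + g s) t"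
    by eventually_elim auto
  then show ?thesis using sq_int_add[OF f(1) g(1)] by (auto simp: rl_space_def)
qed

lemma rl_space_zero: "(\<lambda>t. 0) \<in> rl_space \<gamma> T"
proof -
  have "(\<lambda>t. 0) \<in> sq_int T" "\<And>t. rl_int \<gamma> (\<lambda>t. 0) t = 0" by (simp_all add: sq_int_def rl_int_def)
  then show ?thesis unfolding rl_space_def by force
qed

lemma rl_space_sum:
  assumes "0 \<le> \<gamma>" "\<And>i. i \<in> I \<Longrightarrow> v i \<in> rl_space \<gamma> T"
  shows "(\<lambda>t. \<Sum>i\<in>I. v i t) \<in> rl_space \<gamma> T"
  using assms(2)
proof (induction I rule: infinite_finite_induct)
  case (insert i I)
  have "(\<lambda>t. v i t + (\<Sum>i\<in>I. v i t)) \<in> rl_space \<gamma> T"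
    by (intro rl_space_add assms(1) insert) (use insert in auto)
  then show ?case using insert by simp
qed (simp_all add: rl_space_zero)

text \<open>Since \<open>J\<^sup>b = J\<^sup>a J\<^bsup>b - a\<^esup>\<close> and \<open>J\<^bsup>b - a\<^esup>\<close> maps \<open>L\<^sup>2\<close> to itself.\<close>
lemma rl_space_antimono:
  assumes "0 \<le> a" "a \<le> b" shows "rl_space b T \<subseteq> rl_space a T"
proof
  fix v assume "v \<in> rl_space b T"
  then obtain w where w: "w \<in> sq_int T" "AE t in lborel. t \<in> {0<..<T} \<longrightarrow> v t = rl_int b w t"
    by (auto simp: rl_space_def)
  have "AE t in lborel. t \<in> {0<..<T} \<longrightarrow> rl_int a (cutoff T (rl_int (b - a) w)) t = rl_int (a + (b - a)) w t"
    using assms w by (intro rl_int_semigroup) auto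
  with w(2) have "AE t in lborel. t \<in> {0<..<T} \<longrightarrow> v t = rl_int a (cutoff T (rl_int (b - a) w)) t"
    by eventually_elim auto
  moreover have "cutoff T (rl_int (b - a) w) \<in> sq_int T" using assms w by (intro cutoff_rl_int_sq_int) auto
  ultimately show "v \<in> rl_space a T" by (auto simp: rl_space_def)
qed

lemma rl_space_rl_int:
  assumes ab: "0 \<le> a" "0 \<le> b" and w: "w \<in> sq_int T" "w \<in> rl_space b T"
    and v: "AE t in lborel. t \<in> {0<..<T} \<longrightarrow> v t = rl_int a w t"
  shows "v \<in> rl_space (a + b) T"
proof -
  obtain z where z: "z \<in> sq_int T" "AE t in lborel. t \<in> {0<..<T} \<longrightarrow> w t = rl_int b z t"
    using w by (auto simp: rl_space_def)
  note [measurable] = sq_int_measurable[OF w(1)] sq_int_measurable[OF z(1)]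
  have "AE t in lborel. w t = cutoff T (rl_int b z) t"
    using z(2) by eventually_elim (use sq_int_outside[OF w(1)] in \<open>auto simp: cutoff_def\<close>)
  then have "AE t in lborel. rl_int a w t = rl_int a (cutoff T (rl_int b z)) t"
    by (intro rl_int_AE_cong) auto
  with v rl_int_semigroup[OF ab z(1)]
  have "AE t in lborel. t \<in> {0<..<T} \<longrightarrow> v t = rl_int (a + b) z t"
    by eventually_elim auto
  then show ?thesis using z by (auto simp: rl_space_def)
qed

lemma rl_space_imp_sq_int:
  assumes "0 \<le> \<gamma>" "v \<in> rl_space \<gamma> T" and [measurable]: "v \<in> borel_measurable borel"
    and out: "\<And>t. t \<notin> {0<..<T} \<Longrightarrow> v t = 0"
  shows "v \<in> sq_int T"
proof -
  obtain w where w: "w \<in> sq_int T" and eq: "AE t in lborel. t \<in> {0<..<T} \<longrightarrow> v t = rl_int \<gamma> w t"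
    using assms by (auto simp: rl_space_def)
  note [measurable] = sq_int_measurable[OF w]
  have "AE t in lborel. (cutoff T (rl_int \<gamma> w) t)\<^sup>2 = (v t)\<^sup>2"
    using eq by eventually_elim (use out in \<open>auto simp: cutoff_def\<close>)
  then have "integrable lborel (\<lambda>t. (v t)\<^sup>2)"
    using sq_int_square[OF cutoff_rl_int_sq_int[OF assms(1) w]]
    by (subst integrable_cong_AE[symmetric]) auto
  then show ?thesis using out by (auto simp: sq_int_def)
qed

section \<open>Borel representatives\<close>

lemma AE_lebesgue_on_Ioo:
  "(AE t in lebesgue_on {0<..<T::real}. P t) \<longleftrightarrow> (AE t in lborel. t \<in> {0<..<T} \<longrightarrow> P t)"
  by (subst AE_restrict_space_iff) (auto simp: AE_completion_iff)

lemma borel_representative: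
  assumes "f \<in> borel_measurable (lebesgue_on {0<..<T::real})"
  obtains g :: "real \<Rightarrow> real" where "g \<in> borel_measurable borel" "\<And>t. t \<notin> {0<..<T} \<Longrightarrow> g t = 0"
    "AE t in lborel. t \<in> {0<..<T} \<longrightarrow> f t = g t"
proof -
  have "(\<lambda>t. if t \<in> {0<..<T} then f t else 0) \<in> borel_measurable lebesgue"
    by (rule borel_measurable_if_I[OF assms]) simp
  then obtain h where h: "h \<in> borel_measurable lborel"
    "AE t in lborel. (if t \<in> {0<..<T} then f t else 0) = h t"
    using completion_ex_borel_measurable_real by blast
  have "AE t in lborel. t \<in> {0<..<T} \<longrightarrow> f t = cutoff T h t"
    using h(2) by eventually_elim (auto simp: cutoff_def)
  then show ?thesis using h(1) by (intro that[of "cutoff T h"]) (auto simp: cutoff_def)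
qed

lemma measurable_lebesgue_on_borel:
  "g \<in> borel_measurable borel \<Longrightarrow> g \<in> borel_measurable (lebesgue_on S)"
  by (simp add: measurable_completion measurable_restrict_space1)

lemma
  fixes f g :: "real \<Rightarrow> real"
  assumes f: "f \<in> borel_measurable (lebesgue_on {0<..<T})" and g: "g \<in> borel_measurable borel"
    and out: "\<And>t. t \<notin> {0<..<T} \<Longrightarrow> g t = 0" and eq: "AE t in lborel. t \<in> {0<..<T} \<longrightarrow> f t = g t"
  shows integral_lebesgue_on_Ioo: "(LINT t|lebesgue_on {0<..<T}. f t) = (\<integral>t. g t \<partial>lborel)"
    and integrable_lebesgue_on_Ioo: "integrable (lebesgue_on {0<..<T}) f \<longleftrightarrow> integrable lborel g"
proof -
  let ?f = "\<lambda>t. if t \<in> {0<..<T} then f t else 0"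
  have m: "?f \<in> borel_measurable lebesgue" "g \<in> borel_measurable lebesgue"
    using borel_measurable_if_I[OF f] g by (auto simp: measurable_completion)
  have ae: "AE t in lebesgue. ?f t = g t"
    using eq out by (auto simp: AE_completion_iff)
  have "(LINT t|lebesgue_on {0<..<T}. f t) = integral\<^sup>L lebesgue ?f"
    by (rule Lebesgue_Measure.integral_restrict_UNIV[symmetric]) simp
  also have "\<dots> = integral\<^sup>L lebesgue g" by (rule integral_cong_AE[OF m ae])
  also have "\<dots> = (\<integral>t. g t \<partial>lborel)" using g by (simp add: integral_completion)
  finally show "(LINT t|lebesgue_on {0<..<T}. f t) = (\<integral>t. g t \<partial>lborel)" .
  have "integrable (lebesgue_on {0<..<T}) f \<longleftrightarrow> integrable lebesgue ?f"
    by (rule Lebesgue_Measure.integrable_restrict_UNIV[symmetric]) simp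
  also have "\<dots> \<longleftrightarrow> integrable lebesgue g" by (rule integrable_cong_AE[OF m ae])
  also have "\<dots> \<longleftrightarrow> integrable lborel g" using g by (simp add: integrable_completion)
  finally show "integrable (lebesgue_on {0<..<T}) f \<longleftrightarrow> integrable lborel g" .
qed

lemma L2_representative:
  assumes "w \<in> L2 T"
  obtains w' where "w' \<in> sq_int T" "AE t in lborel. t \<in> {0<..<T} \<longrightarrow> w t = w' t"
proof -
  have w: "w \<in> borel_measurable (lebesgue_on {0<..<T})"
    "integrable (lebesgue_on {0<..<T}) (\<lambda>t. (w t)\<^sup>2)"
    using assms by (auto simp: L2_def)
  obtain g where g: "g \<in> borel_measurable borel" "\<And>t. t \<notin> {0<..<T} \<Longrightarrow> g t = 0"
    "AE t in lborel. t \<in> {0<..<T} \<longrightarrow> w t = g t"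
    using borel_representative[OF w(1)] by blast
  have "AE t in lborel. t \<in> {0<..<T} \<longrightarrow> (w t)\<^sup>2 = (g t)\<^sup>2" using g(3) by eventually_elim auto
  then have "integrable lborel (\<lambda>t. (g t)\<^sup>2)"
    using w g by (subst integrable_lebesgue_on_Ioo[where f = "\<lambda>t. (w t)\<^sup>2", symmetric]) auto
  with g show ?thesis by (intro that[of g]) (auto simp: sq_int_def)
qed

lemma sq_int_imp_L2: assumes w: "w \<in> sq_int T" shows "w \<in> L2 T"
proof -
  note [measurable] = sq_int_measurable[OF w]
  have m: "w \<in> borel_measurable (lebesgue_on {0<..<T})" by (rule measurable_lebesgue_on_borel) simp
  then have "integrable (lebesgue_on {0<..<T}) (\<lambda>t. (w t)\<^sup>2)"
    using sq_int_square[OF w] sq_int_outside[OF w]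
    by (subst integrable_lebesgue_on_Ioo[where g = "\<lambda>t. (w t)\<^sup>2"]) auto
  with m show ?thesis by (simp add: L2_def)
qed

text \<open>The integral over \<open>(0,t)\<close> may be extended to the whole line: the kernel vanishes for \<open>s \<ge> t\<close> and the
  representative for \<open>s \<le> 0\<close>.\<close>
lemma frac_int_eq_rl_int:
  assumes \<gamma>: "0 < \<gamma>" and w: "w \<in> borel_measurable (lebesgue_on {0<..<T})"
    and w': "w' \<in> sq_int T" and eq: "AE t in lborel. t \<in> {0<..<T} \<longrightarrow> w t = w' t" and t: "t \<in> {0<..<T}"
  shows "frac_int \<gamma> w t = rl_int \<gamma> w' t"
proof -
  note [measurable] = sq_int_measurable[OF w']
  let ?k = "\<lambda>s. indicator {0<..<t} s * (t - s) powr (\<gamma> - 1)"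
  have k: "?k \<in> borel_measurable borel" by measurable
  have m: "(\<lambda>s. if s \<in> {0<..<T} then w s else 0) \<in> borel_measurable lebesgue"
    by (rule borel_measurable_if_I[OF w]) simp
  have "(LINT s:{0<..<t}|lebesgue. (t - s) powr (\<gamma> - 1) * w s)
      = (\<integral>s. ?k s * (if s \<in> {0<..<T} then w s else 0) \<partial>lebesgue)"
    unfolding set_lebesgue_integral_def
    using t by (intro Bochner_Integration.integral_cong) (auto simp: indicator_def)
  also have "\<dots> = (\<integral>s. ?k s * w' s \<partial>lebesgue)"
  proof (rule integral_cong_AE)
    show "(\<lambda>s. ?k s * (if s \<in> {0<..<T} then w s else 0)) \<in> borel_measurable lebesgue"
      using k m by (intro borel_measurable_times) (simp_all add: measurable_completion)
    show "(\<lambda>s. ?k s * w' s) \<in> borel_measurable lebesgue"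
      by (intro measurable_completion) measurable
    have "AE s in lborel. ?k s * (if s \<in> {0<..<T} then w s else 0) = ?k s * w' s"
      using eq by eventually_elim (use t in \<open>auto simp: indicator_def\<close>)
    then show "AE s in lebesgue. ?k s * (if s \<in> {0<..<T} then w s else 0) = ?k s * w' s"
      by (simp only: AE_completion_iff)
  qed
  also have "\<dots> = (\<integral>s. ?k s * w' s \<partial>lborel)" by (rule integral_completion) measurable
  finally have "frac_int \<gamma> w t = (\<integral>s. 1 / Gamma \<gamma> * (?k s * w' s) \<partial>lborel)"
    by (simp add: frac_int_def)
  also have "\<dots> = (\<integral>s. rl_kernel \<gamma> (t - s) * w' s \<partial>lborel)"
  proof (rule Bochner_Integration.integral_cong)
    fix s show "1 / Gamma \<gamma> * (?k s * w' s) = rl_kernel \<gamma> (t - s) * w' s"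
      using sq_int_outside[OF w', of s]
      by (cases "0 < s") (auto simp: rl_kernel_def indicator_def)
  qed simp
  finally show ?thesis using \<gamma> by (simp add: rl_int_def)
qed

lemma frac_sobolev_eq_rl_space:
  assumes \<gamma>: "0 < \<gamma>" shows "frac_sobolev \<gamma> T = rl_space \<gamma> T"
proof (intro set_eqI iffI)
  fix v assume "v \<in> frac_sobolev \<gamma> T"
  then obtain w where w: "w \<in> L2 T" "AE t in lborel. t \<in> {0<..<T} \<longrightarrow> v t = frac_int \<gamma> w t"
    by (auto simp: frac_sobolev_def AE_lebesgue_on_Ioo)
  obtain w' where w': "w' \<in> sq_int T" "AE t in lborel. t \<in> {0<..<T} \<longrightarrow> w t = w' t"
    using L2_representative[OF w(1)] .
  have "AE t in lborel. t \<in> {0<..<T} \<longrightarrow> v t = rl_int \<gamma> w' t"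
    using w(2) by eventually_elim
      (use frac_int_eq_rl_int[OF \<gamma> _ w'] w(1) in \<open>auto simp: L2_def\<close>)
  with w' show "v \<in> rl_space \<gamma> T" by (auto simp: rl_space_def)
next
  fix v assume "v \<in> rl_space \<gamma> T"
  then obtain w where w: "w \<in> sq_int T" "AE t in lborel. t \<in> {0<..<T} \<longrightarrow> v t = rl_int \<gamma> w t"
    by (auto simp: rl_space_def)
  have L: "w \<in> L2 T" by (rule sq_int_imp_L2[OF w(1)])
  have "AE t in lborel. t \<in> {0<..<T} \<longrightarrow> v t = frac_int \<gamma> w t"
    using w(2) by eventually_elim
      (use frac_int_eq_rl_int[OF \<gamma> _ w(1)] L in \<open>auto simp: L2_def\<close>)
  with L show "v \<in> frac_sobolev \<gamma> T" by (auto simp: frac_sobolev_def AE_lebesgue_on_Ioo)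
qed

lemma Linf_representative:
  assumes "f \<in> Linf T"
  obtains g C where "g \<in> borel_measurable borel" "\<And>t. \<bar>g t\<bar> \<le> C" "\<And>t. t \<notin> {0<..<T} \<Longrightarrow> g t = 0"
    "AE t in lborel. t \<in> {0<..<T} \<longrightarrow> f t = g t"
proof -
  obtain C where f: "f \<in> borel_measurable (lebesgue_on {0<..<T})"
    and C: "AE t in lborel. t \<in> {0<..<T} \<longrightarrow> \<bar>f t\<bar> \<le> C"
    using assms by (auto simp: Linf_def AE_lebesgue_on_Ioo)
  obtain h where h: "h \<in> borel_measurable borel" "\<And>t. t \<notin> {0<..<T} \<Longrightarrow> h t = 0"
    "AE t in lborel. t \<in> {0<..<T} \<longrightarrow> f t = h t"
    using borel_representative[OF f] by blast
  note [measurable] = h(1)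
  let ?g = "\<lambda>t. if \<bar>h t\<bar> \<le> C then h t else 0"
  show ?thesis
  proof (rule that[of ?g "\<bar>C\<bar>"])
    show "AE t in lborel. t \<in> {0<..<T} \<longrightarrow> f t = ?g t"
      using C h(3) by eventually_elim auto
  qed (use h(2) in auto)
qed

lemma bounded_imp_Linf:
  assumes "g \<in> borel_measurable borel" "\<And>t. \<bar>g t\<bar> \<le> C" shows "g \<in> Linf T"
  using assms measurable_lebesgue_on_borel by (auto simp: Linf_def)

lemma weak_deriv_representative:
  assumes f: "f \<in> Linf T" and g: "g \<in> Linf T"
    and f': "f' \<in> borel_measurable borel" "\<And>t. t \<notin> {0<..<T} \<Longrightarrow> f' t = 0"
      "AE t in lborel. t \<in> {0<..<T} \<longrightarrow> f t = f' t"
    and g': "g' \<in> borel_measurable borel" "\<And>t. t \<notin> {0<..<T} \<Longrightarrow> g' t = 0"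
      "AE t in lborel. t \<in> {0<..<T} \<longrightarrow> g t = g' t"
  shows "weak_deriv k T f g \<longleftrightarrow>
    (\<forall>\<phi>\<in>test_fun T. (\<integral>t. f' t * (deriv ^^ k) \<phi> t \<partial>lborel) = (-1) ^ k * (\<integral>t. g' t * \<phi> t \<partial>lborel))"
proof -
  have *: "(LINT t|lebesgue_on {0<..<T}. h t * \<phi> t) = (\<integral>t. h' t * \<phi> t \<partial>lborel)"
    if h: "h \<in> Linf T" "h' \<in> borel_measurable borel" "\<And>t. t \<notin> {0<..<T} \<Longrightarrow> h' t = 0"
      "AE t in lborel. t \<in> {0<..<T} \<longrightarrow> h t = h' t" and \<phi>: "\<phi> \<in> test_fun T" for h h' \<phi>
  proof (rule integral_lebesgue_on_Ioo)
    note \<phi>m = test_fun_measurable[OF \<phi>]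
    show "(\<lambda>t. h t * \<phi> t) \<in> borel_measurable (lebesgue_on {0<..<T})"
      using h(1) measurable_lebesgue_on_borel[OF \<phi>m] by (auto simp: Linf_def)
    show "(\<lambda>t. h' t * \<phi> t) \<in> borel_measurable borel" using h(2) \<phi>m by simp
    show "AE t in lborel. t \<in> {0<..<T} \<longrightarrow> h t * \<phi> t = h' t * \<phi> t"
      using h(4) by eventually_elim auto
  qed (use h(3) in auto)
  show ?thesis
    unfolding weak_deriv_def
    using *[OF f f' test_fun_funpow_deriv] *[OF g g'] by simp
qed

section \<open>Multiplication by Sobolev functions\<close>

lemma sobolev_inf_mono: "m \<le> n \<Longrightarrow> sobolev_inf n T \<subseteq> sobolev_inf m T"
  unfolding sobolev_inf_def using order_trans by blast

text \<open>Shifting the order in the weak formulation (a derivative of a test function is a test function)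
  shows that the higher weak derivatives of \<open>P\<close> are those of its first one.\<close>
lemma sobolev_inf_Suc_primitive:
  assumes T: "0 < T" and P: "P \<in> sobolev_inf (Suc n) T"
  obtains p c C where "p \<in> sobolev_inf n T" "p \<in> borel_measurable borel" "\<And>t. \<bar>p t\<bar> \<le> C" "p \<in> sq_int T"
    "AE t in lborel. t \<in> {0<..<T} \<longrightarrow> P t = c + rl_int 1 p t"
proof -
  have PL: "P \<in> Linf T" and der: "\<And>k. k \<le> Suc n \<Longrightarrow> \<exists>g\<in>Linf T. weak_deriv k T P g"
    using P by (auto simp: sobolev_inf_def)
  obtain P0 C0 where P0: "P0 \<in> borel_measurable borel" "\<And>t. \<bar>P0 t\<bar> \<le> C0" "\<And>t. t \<notin> {0<..<T} \<Longrightarrow> P0 t = 0"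
    "AE t in lborel. t \<in> {0<..<T} \<longrightarrow> P t = P0 t"
    using Linf_representative[OF PL] by blast
  obtain g where g: "g \<in> Linf T" "weak_deriv 1 T P g" using der[of 1] by auto
  obtain p C where p: "p \<in> borel_measurable borel" "\<And>t. \<bar>p t\<bar> \<le> C" "\<And>t. t \<notin> {0<..<T} \<Longrightarrow> p t = 0"
    "AE t in lborel. t \<in> {0<..<T} \<longrightarrow> g t = p t"
    using Linf_representative[OF g(1)] by blast
  have weak: "(\<integral>t. P0 t * deriv \<phi> t \<partial>lborel) = - (\<integral>t. p t * \<phi> t \<partial>lborel)" if "\<phi> \<in> test_fun T" for \<phi>
    using weak_deriv_representative[OF PL g(1) P0(1,3,4) p(1,3,4), of 1] g(2) that by simp
  have psq: "p \<in> sq_int T" using p by (intro bounded_sq_int) auto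
  obtain c where "AE t in lborel. t \<in> {0<..<T} \<longrightarrow> P0 t = c + rl_int 1 p t"
    using primitive_of_weak_derivative[OF T P0(1,2) psq weak] by blast
  with P0(4) have c: "AE t in lborel. t \<in> {0<..<T} \<longrightarrow> P t = c + rl_int 1 p t"
    by eventually_elim auto
  have pL: "p \<in> Linf T" by (rule bounded_imp_Linf[OF p(1,2)])
  have "\<exists>h\<in>Linf T. weak_deriv k T p h" if "k \<le> n" for k
  proof -
    have "Suc k \<le> Suc n" using that by simp
    from der[OF this] obtain h where h: "h \<in> Linf T" "weak_deriv (Suc k) T P h" by blast
    obtain h0 Ch where h0: "h0 \<in> borel_measurable borel" "\<And>t. \<bar>h0 t\<bar> \<le> Ch" "\<And>t. t \<notin> {0<..<T} \<Longrightarrow> h0 t = 0"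
      "AE t in lborel. t \<in> {0<..<T} \<longrightarrow> h t = h0 t"
      using Linf_representative[OF h(1)] by blast
    have "(\<integral>t. p t * (deriv ^^ k) \<phi> t \<partial>lborel) = (-1) ^ k * (\<integral>t. h0 t * \<phi> t \<partial>lborel)"
      if \<phi>: "\<phi> \<in> test_fun T" for \<phi>
    proof -
      have "(\<integral>t. P0 t * (deriv ^^ Suc k) \<phi> t \<partial>lborel) = (-1) ^ Suc k * (\<integral>t. h0 t * \<phi> t \<partial>lborel)"
        using weak_deriv_representative[OF PL h(1) P0(1,3,4) h0(1,3,4), of "Suc k"] h(2) \<phi> by blast
      then show ?thesis using weak[OF test_fun_funpow_deriv[OF \<phi>, of k]] by simp
    qed
    then have "weak_deriv k T p h"
      using weak_deriv_representative[OF pL h(1) p(1,3) _ h0(1,3,4), of k] by simp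
    then show ?thesis using h(1) by blast
  qed
  then have "p \<in> sobolev_inf n T" using pL by (auto simp: sobolev_inf_def)
  then show ?thesis by (rule that[OF _ p(1,2) psq c])
qed

lemma rl_space_0: "v \<in> rl_space 0 T \<longleftrightarrow> (\<exists>w\<in>sq_int T. AE t in lborel. t \<in> {0<..<T} \<longrightarrow> v t = w t)"
  by (simp add: rl_space_def rl_int_def)

text \<open>Induction on the order. An element of the space of order \<open>n + 1\<close> is a primitive \<open>v = J\<^sup>1 y\<close> with \<open>y\<close>
  of order \<open>n\<close>, and \<open>P\<close> is a constant plus a primitive of \<open>p\<close>. The product rule gives
  \<open>P v = J\<^sup>1 (P y + p v)\<close>, where the two products are of order \<open>n\<close> by the induction hypothesis: \<open>P\<close>, \<open>p\<close>
  have \<open>n\<close> bounded weak derivatives, and \<open>v\<close> lies in the smaller space of order \<open>n + 1\<close>.\<close>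
lemma sobolev_inf_mult_rl_space:
  assumes T: "0 < T"
  shows "P \<in> sobolev_inf n T \<Longrightarrow> v \<in> rl_space (real n) T \<Longrightarrow> (\<lambda>t. P t * v t) \<in> rl_space (real n) T"
proof (induction n arbitrary: P v)
  case 0
  then obtain w where w: "w \<in> sq_int T" "AE t in lborel. t \<in> {0<..<T} \<longrightarrow> v t = w t"
    by (auto simp: rl_space_0)
  have "P \<in> Linf T" using "0.prems"(1) by (simp add: sobolev_inf_def)
  from Linf_representative[OF this]
  obtain P0 C where P0: "P0 \<in> borel_measurable borel" "\<And>t. \<bar>P0 t\<bar> \<le> C"
    and eq: "AE t in lborel. t \<in> {0<..<T} \<longrightarrow> P t = P0 t" by metis
  have "AE t in lborel. t \<in> {0<..<T} \<longrightarrow> P t * v t = P0 t * w t"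
    using w(2) eq by eventually_elim simp
  then show ?case unfolding of_nat_0 rl_space_0 by (rule bexI[OF _ sq_int_bounded_mult[OF P0 w(1)]])
next
  case (Suc n)
  obtain p c C where p: "p \<in> sobolev_inf n T" "p \<in> borel_measurable borel" "\<And>t. \<bar>p t\<bar> \<le> C" "p \<in> sq_int T"
    and P: "AE t in lborel. t \<in> {0<..<T} \<longrightarrow> P t = c + rl_int 1 p t"
    by (rule sobolev_inf_Suc_primitive[OF T Suc.prems(1)]) (rule that)
  obtain z where z: "z \<in> sq_int T" "AE t in lborel. t \<in> {0<..<T} \<longrightarrow> v t = rl_int (1 + real n) z t"
    using Suc.prems(2) by (auto simp: rl_space_def)
  define y where "y = cutoff T (rl_int (real n) z)"
  have y: "y \<in> sq_int T" unfolding y_def by (rule cutoff_rl_int_sq_int[OF _ z(1)]) simp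
  have vy: "AE t in lborel. t \<in> {0<..<T} \<longrightarrow> v t = rl_int 1 y t"
  proof -
    have "AE t in lborel. t \<in> {0<..<T} \<longrightarrow> rl_int 1 y t = rl_int (1 + real n) z t"
      unfolding y_def by (rule rl_int_semigroup[OF _ _ z(1)]) simp_all
    with z(2) show ?thesis by eventually_elim simp
  qed
  note [measurable] = p(2) sq_int_measurable[OF y]
  have yn: "y \<in> rl_space (real n) T"
    using z(1) unfolding rl_space_def y_def cutoff_def by auto
  have vn: "v \<in> rl_space (real n) T"
    using Suc.prems(2) rl_space_antimono[of "real n" "real (Suc n)" T] by auto
  have Pn: "P \<in> sobolev_inf n T" using Suc.prems(1) sobolev_inf_mono[of n "Suc n"] by auto
  (* With the primitives written out, r is a Borel representative of P y + p v. *)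
  define q where "q s = p s * rl_int 1 y s + rl_int 1 p s * y s" for s
  define r where "r s = c * y s + q s" for s
  have [measurable]: "r \<in> borel_measurable borel" unfolding r_def[abs_def] q_def by measurable
  have "(\<lambda>t. P t * y t + p t * v t) \<in> rl_space (real n) T"
    by (intro rl_space_add Suc.IH Pn yn p(1) vn) simp
  moreover have "AE t in lborel. t \<in> {0<..<T} \<longrightarrow> r t = P t * y t + p t * v t"
    using P vy by eventually_elim (auto simp: r_def q_def algebra_simps)
  ultimately have rn: "r \<in> rl_space (real n) T" by (rule rl_space_cong)
  have r: "r \<in> sq_int T"
    by (rule rl_space_imp_sq_int[OF _ rn])
       (use sq_int_outside[OF y] sq_int_outside[OF p(4)] in \<open>auto simp: r_def q_def\<close>)
  note int = sq_int_integrable[OF y] sq_int_integrable[OF p(4)] sq_int_integrable[OF r]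
  have qi: "integrable lborel q"
    using integrable_mult_rl_int_1[OF int(2,1)] integrable_mult_rl_int_1[OF int(1,2)]
    unfolding q_def[abs_def] by (simp add: mult.commute)
  have prod: "rl_int 1 r t = (c + rl_int 1 p t) * rl_int 1 y t" for t
  proof -
    have "rl_int 1 r t = (\<integral>s. c * (y s * indicator {..<t} s) + q s * indicator {..<t} s \<partial>lborel)"
      unfolding rl_int_1 r_def by (simp add: distrib_right mult.assoc)
    also have "\<dots> = c * rl_int 1 y t + rl_int 1 q t"
      unfolding rl_int_1 using integrable_mult_indicator_lessThan[OF int(1)] integrable_mult_indicator_lessThan[OF qi] by simp
    also have "rl_int 1 q t = rl_int 1 p t * rl_int 1 y t"
      using rl_int_1_product[OF int(2,1)] by (simp add: q_def[abs_def])
    finally show ?thesis by (simp add: distrib_right)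
  qed
  have "AE t in lborel. t \<in> {0<..<T} \<longrightarrow> P t * v t = rl_int 1 r t"
    using P vy by eventually_elim (simp add: prod)
  then have "(\<lambda>t. P t * v t) \<in> rl_space (1 + real n) T"
    using r rn by (intro rl_space_rl_int[where w = r]) auto
  then show ?case by simp
qed

section \<open>Regularity of solutions\<close>

theorem theorem2p2:
  fixes T \<alpha> \<beta> :: real and m :: nat
    and a0 a1 :: "real ^ 'n"
    and P :: "real \<Rightarrow> real ^ 'n ^ 'n"
    and F u :: "real \<Rightarrow> real ^ 'n"
  assumes "T > 0"
    and "1 < \<alpha>" and "\<alpha> \<le> 2"
    and "m \<ge> 1" and "real m - 1 < \<beta>" and "\<beta> \<le> real m"
    and "P \<in> mat_in (sobolev_inf m T)"
    and "(\<lambda>t. F t + P t *v a0 + t *\<^sub>R (P t *v a1)) \<in> vec_in (frac_sobolev \<beta> T)"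
    and "is_solution \<alpha> T a0 a1 P F u"
  shows "(\<lambda>t. u t - a0 - t *\<^sub>R a1) \<in> vec_in (frac_sobolev (\<alpha> + \<beta>) T)"
proof -
  have \<beta>: "0 < \<beta>" using assms(4,5) by simp
  define v where "v i t = (u t - a0 - t *\<^sub>R a1) $ i" for i t
  define G where "G i t = (F t + P t *v a0 + t *\<^sub>R (P t *v a1)) $ i" for i t
  define d where "d i = frac_deriv \<alpha> T (v i)" for i
  have P: "(\<lambda>t. P t $ i $ j) \<in> sobolev_inf m T" for i j
    using assms(7) by (simp add: mat_in_def)
  have G: "G i \<in> rl_space \<beta> T" for i
    using assms(8) \<beta> by (simp add: vec_in_def G_def[abs_def] frac_sobolev_eq_rl_space)
  have vi: "v i \<in> frac_sobolev \<alpha> T" for i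
    using assms(9) by (simp add: is_solution_def vec_in_def v_def[abs_def])
  have "\<exists>w. w \<in> L2 T \<and> (AE t in lebesgue_on {0<..<T}. v i t = frac_int \<alpha> w t)" for i
    using vi[of i] by (auto simp: frac_sobolev_def)
  (* The fractional derivative is a preimage of v i, as v i is in the range of the fractional integral. *)
  from someI_ex[OF this] have "d i \<in> L2 T \<and> (AE t in lebesgue_on {0<..<T}. v i t = frac_int \<alpha> (d i) t)" for i
    unfolding d_def frac_deriv_def .
  then have d: "d i \<in> L2 T" "AE t in lborel. t \<in> {0<..<T} \<longrightarrow> v i t = frac_int \<alpha> (d i) t" for i
    by (auto simp: AE_lebesgue_on_Ioo)
  have eqn: "AE t in lborel. t \<in> {0<..<T} \<longrightarrow> d i t = (\<Sum>j\<in>UNIV. P t $ i $ j * v j t) + G i t" for i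
  proof -
    have "AE t in lborel. t \<in> {0<..<T} \<longrightarrow>
        vec_frac_deriv \<alpha> T (\<lambda>t. u t - a0 - t *\<^sub>R a1) t = P t *v u t + F t"
      using assms(9) by (simp add: is_solution_def AE_lebesgue_on_Ioo)
    then show ?thesis
    proof eventually_elim
      case (elim t)
      show ?case
      proof
        assume "t \<in> {0<..<T}"
        have "d i t = vec_frac_deriv \<alpha> T (\<lambda>t. u t - a0 - t *\<^sub>R a1) t $ i"
          by (simp add: d_def v_def[abs_def] vec_frac_deriv_def)
        also have "\<dots> = (P t *v u t + F t) $ i"
          using elim \<open>t \<in> {0<..<T}\<close> by simp
        also have "\<dots> = (P t *v (u t - a0 - t *\<^sub>R a1)) $ i + G i t"
          by (simp add: G_def matrix_vector_mult_diff_distrib matrix_vector_mult_scaleR)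
        also have "(P t *v (u t - a0 - t *\<^sub>R a1)) $ i = (\<Sum>j\<in>UNIV. P t $ i $ j * v j t)"
          by (simp add: matrix_vector_mult_def v_def)
        finally show "d i t = (\<Sum>j\<in>UNIV. P t $ i $ j * v j t) + G i t" .
      qed
    qed
  qed
  have "\<exists>w. w \<in> sq_int T \<and> (AE t in lborel. t \<in> {0<..<T} \<longrightarrow> d i t = w t)" for i
    using L2_representative[OF d(1)[of i]] by blast
  then obtain w where w: "w i \<in> sq_int T" "AE t in lborel. t \<in> {0<..<T} \<longrightarrow> d i t = w i t" for i
    by metis
  have vw: "AE t in lborel. t \<in> {0<..<T} \<longrightarrow> v i t = rl_int \<alpha> (w i) t" for i
    using d(2)[of i] by eventually_elim
      (use frac_int_eq_rl_int[OF _ _ w(1)[of i] w(2)[of i], of \<alpha>] d(1)[of i] assms(2) in \<open>simp add: L2_def\<close>)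
  have lift: "v i \<in> rl_space (\<alpha> + \<sigma>) T" if "0 \<le> \<sigma>" "w i \<in> rl_space \<sigma> T" for i \<sigma>
    using rl_space_rl_int[OF _ that(1) w(1) that(2) vw] assms(2) by simp
  (* Each pass through the equation gains one order, as \<alpha> > 1, until G stops it at \<beta>. *)
  have "w i \<in> rl_space (min (real k) \<beta>) T" if "k \<le> m" for i k
    using that
  proof (induction k arbitrary: i)
    case 0
    have "w i \<in> rl_space 0 T" unfolding rl_space_0 using w(1)[of i] by (intro bexI[of _ "w i"]) auto
    then show ?case using \<beta> by simp
  next
    case (Suc k)
    (* k \<le> m - 1 < \<beta>, hence the minimum in the induction hypothesis is k. *)
    then have "w j \<in> rl_space (real k) T" for j
      using Suc.IH[of j] assms(5) by (simp add: min_def split: if_splits)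
    then have "v j \<in> rl_space (\<alpha> + real k) T" for j by (intro lift) auto
    then have "v j \<in> rl_space (real (Suc k)) T" for j
      using rl_space_antimono[of "real (Suc k)" "\<alpha> + real k" T] assms(2) by auto
    moreover have "(\<lambda>t. P t $ i $ j) \<in> sobolev_inf (Suc k) T" for j
      using P sobolev_inf_mono[OF Suc.prems] by blast
    ultimately have "(\<lambda>t. P t $ i $ j * v j t) \<in> rl_space (real (Suc k)) T" for j
      by (intro sobolev_inf_mult_rl_space assms(1))
    then have "(\<lambda>t. P t $ i $ j * v j t) \<in> rl_space (min (real (Suc k)) \<beta>) T" for j
      using rl_space_antimono[of "min (real (Suc k)) \<beta>" "real (Suc k)" T] \<beta> by auto
    moreover have "G i \<in> rl_space (min (real (Suc k)) \<beta>) T"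
      using G[of i] rl_space_antimono[of "min (real (Suc k)) \<beta>" \<beta> T] \<beta> by auto
    ultimately have "(\<lambda>t. (\<Sum>j\<in>UNIV. P t $ i $ j * v j t) + G i t) \<in> rl_space (min (real (Suc k)) \<beta>) T"
      using \<beta> by (intro rl_space_add rl_space_sum) auto
    moreover have "AE t in lborel. t \<in> {0<..<T} \<longrightarrow> w i t = (\<Sum>j\<in>UNIV. P t $ i $ j * v j t) + G i t"
      using w(2)[of i] eqn[of i] by eventually_elim auto
    ultimately show ?case by (rule rl_space_cong)
  qed
  moreover have "min (real m) \<beta> = \<beta>" using assms(6) by simp
  ultimately have "w i \<in> rl_space \<beta> T" for i by (metis order_refl)
  then have "v i \<in> rl_space (\<alpha> + \<beta>) T" for i using \<beta> by (intro lift) auto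
  then show ?thesis
    using \<beta> assms(2) by (simp add: vec_in_def v_def[abs_def] frac_sobolev_eq_rl_space)
qed

end
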